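(* Let $(\pi,\rho,V)$ be a complex representation of the real Lie supergroup $\mathrm{SU}(1|1)$ such that the weight spaces $V_m:=\{v\in V: t\cdot v=t^m v\text{ for all }t\in S^1\}$, $m\in\mathbb Z$, for the reduced group $S^1$ are all finite-dimensional. Then $(\pi,\rho,V)$ is isomorphic to $$V_0\oplus\bigoplus_m W_m^+\oplus\bigoplus_k W_k^-,$$ where $V_0$ is the weight space of weight $0$ and the $W_m^{+}$, $W_k^-$ ($m,k$ nonzero integers) are super weight spaces, repeated according to their multiplicities.
   Context: The supergroup $\mathrm{SU}(1|1)$ (also denoted $S^{1|2}$) is described by the super Harish-Chandra pair consisting of the reduced group $S^1$ and the real Lie superalgebra $\mathfrak{su}(1|1)$ of dimension $1|2$ spanned by $$C=\begin{pmatrix} i&0\\0&i\end{pmatrix}\ (\text{even}),\qquad U=\begin{pmatrix}0&1\\-i&0\end{pmatrix},\quad S=\begin{pmatrix}0&i\\-1&0\end{pmatrix}\ (\text{odd}),$$ with brackets $[C,U]=[C,S]=[U,S]=0$, $[U,U]=[S,S]=-2C$ (the bracket of two odd elements is the anticommutator). Here $S^1$ is the group of matrices $\mathrm{diag}(t,t)$, $|t|=1$, with Lie algebra spanned by $C$; its adjoint action on $\mathfrak{su}(1|1)$ is trivial. A (complex) representation $(\pi,\rho,V)$ of $\mathrm{SU}(1|1)$ is a complex super vector space $V=V_{\bar0}\oplus V_{\bar1}$ with a representation $\pi$ of $S^1$ on $V$ by even (parity-preserving) linear automorphisms and a Lie superalgebra morphism $\rho:\mathfrak{su}(1|1)\to\mathrm{End}(V)$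 such that $\rho(C)=d\pi(C)$ (so $\rho(C)$ acts as $im$ on vectors on which $t\in S^1$ acts by $t^m$) and $\rho(U),\rho(S)$ commute with $\pi(S^1)$. Isomorphisms of representations are even linear isomorphisms intertwining $\pi$ and $\rho$. For a nonzero integer $m$, the super weight spaces $W_m^{\pm}\simeq\mathbb C^{1|1}$ are the representations in which $t\in S^1$ acts by $t^m$ and, with respect to a basis (even vector, odd vector) and a fixed choice of square root $\sqrt{-im}$, $$C=\begin{pmatrix} im&0\\0&im\end{pmatrix},\quad U=\begin{pmatrix}0&\sqrt{-im}\\ \sqrt{-im}&0\end{pmatrix},\quad S=\begin{pmatrix}0&\frac{\mp m}{\sqrt{-im}}\\ \frac{\pm m}{\sqrt{-im}}&0\end{pmatrix},$$ where the upper signs are for $W_m^+$ and the lower signs for $W_m^-$. *)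

theory Defs
  imports "HOL-Analysis.Analysis" "HOL-Library.Function_Algebras"
begin

section \<open>The Lie superalgebra \<open>su(1|1)\<close>\<close>

definition mat2 :: "complex \<Rightarrow> complex \<Rightarrow> complex \<Rightarrow> complex \<Rightarrow> complex^2^2" where
  "mat2 a b c d = vector [vector [a, b], vector [c, d]]"

definition gen_C :: "complex^2^2" where "gen_C = mat2 \<i> 0 0 \<i>"
definition gen_U :: "complex^2^2" where "gen_U = mat2 0 1 (- \<i>) 0"
definition gen_S :: "complex^2^2" where "gen_S = mat2 0 \<i> (- 1) 0"

text \<open>Here \<^const>\<open>span\<close> is the real span.\<close>

definition su11_even :: "(complex^2^2) set" where "su11_even = span {gen_C}"
definition su11_odd :: "(complex^2^2) set" where "su11_odd = span {gen_U, gen_S}"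
definition su11 :: "(complex^2^2) set" where "su11 = span {gen_C, gen_U, gen_S}"

text \<open>The super bracket is the commutator if one argument is even and the anticommutator
  if both are odd.\<close>

definition commutator :: "complex^2^2 \<Rightarrow> complex^2^2 \<Rightarrow> complex^2^2" where
  "commutator X Y = X ** Y - Y ** X"
definition anticommutator :: "complex^2^2 \<Rightarrow> complex^2^2 \<Rightarrow> complex^2^2" where
  "anticommutator X Y = X ** Y + Y ** X"

lemma su11_brackets:
  "commutator gen_C gen_U = 0" "commutator gen_C gen_S = 0"
  "anticommutator gen_U gen_S = 0"
  "anticommutator gen_U gen_U = (- 2) *\<^sub>R gen_C"
  "anticommutator gen_S gen_S = (- 2) *\<^sub>R gen_C"
  by (simp_all add: commutator_def anticommutator_def gen_C_def gen_U_def gen_S_def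
      mat2_def vec_eq_iff forall_2 matrix_matrix_mult_def sum_2 complex_eq_iff)


section \<open>Representations of \<open>SU(1|1)\<close>\<close>

text \<open>The underlying super vector space is \<open>carrier R = ev R \<oplus> od R\<close> inside an ambient complex
  vector space. The actions are only relevant on the carrier, for \<open>t\<close> on the unit circle
  and for \<open>X\<close> in \<^const>\<open>su11\<close>; the group element \<open>diag(t,t)\<close> is written \<open>t\<close>.\<close>

record 'v su11_data =
  scl :: "complex \<Rightarrow> 'v \<Rightarrow> 'v"
  ev :: "'v set"
  od :: "'v set"
  act :: "complex \<Rightarrow> 'v \<Rightarrow> 'v"
  rho :: "complex^2^2 \<Rightarrow> 'v \<Rightarrow> 'v"

abbreviation S1 :: "complex set" where "S1 \<equiv> sphere 0 1"

definition carrier :: "('v::ab_group_add) su11_data \<Rightarrow> 'v set" where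
  "carrier R = {x + y | x y. x \<in> ev R \<and> y \<in> od R}"

text \<open>\<open>w\<close> is the value at \<open>v\<close> of the differential of the group action in the direction of
  \<^const>\<open>gen_C\<close>, whose one-parameter group is \<open>\<theta> \<mapsto> cis \<theta>\<close>. As the vector space
  carries no topology, the derivative is taken in every matrix coefficient
  \<open>\<theta> \<mapsto> \<phi> (cis \<theta> \<cdot> v)\<close> with \<open>\<phi>\<close> a complex linear functional;
  in finite dimension this is the usual derivative.\<close>

definition has_differential :: "('v::ab_group_add) su11_data \<Rightarrow> 'v \<Rightarrow> 'v \<Rightarrow> bool" where
  "has_differential R v w \<longleftrightarrow>
     (\<forall>\<phi>. Vector_Spaces.linear (scl R) (*) \<phi> \<longrightarrow>
        ((\<lambda>\<theta>. \<phi> (act R (cis \<theta>) v)) has_vector_derivative \<phi> w) (at 0))"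

definition linear_map_on ::
  "(complex \<Rightarrow> 'v \<Rightarrow> 'v::ab_group_add) \<Rightarrow> (complex \<Rightarrow> 'w \<Rightarrow> 'w::ab_group_add) \<Rightarrow> 'v set \<Rightarrow> ('v \<Rightarrow> 'w) \<Rightarrow> bool"
  where "linear_map_on s s' V f \<longleftrightarrow>
     (\<forall>x\<in>V. \<forall>y\<in>V. f (x + y) = f x + f y) \<and> (\<forall>c. \<forall>x\<in>V. f (s c x) = s' c (f x))"

locale su11_representation =
  fixes R :: "('v::ab_group_add) su11_data"
  assumes vector_space: "vector_space (scl R)"
    and subspace_even: "module.subspace (scl R) (ev R)"
    and subspace_odd: "module.subspace (scl R) (od R)"
    and even_Int_odd: "ev R \<inter> od R = {0}"
    \<comment> \<open>\<^const>\<open>act\<close>: a representation of the circle by even automorphisms\<close>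
    and grp_linear: "t \<in> S1 \<Longrightarrow>
      linear_map_on (scl R) (scl R) (carrier R) (act R t)"
    and grp_even: "t \<in> S1 \<Longrightarrow> act R t ` ev R \<subseteq> ev R"
    and grp_odd: "t \<in> S1 \<Longrightarrow> act R t ` od R \<subseteq> od R"
    and grp_one: "v \<in> carrier R \<Longrightarrow> act R 1 v = v"
    and grp_mult: "s \<in> S1 \<Longrightarrow> t \<in> S1 \<Longrightarrow> v \<in> carrier R \<Longrightarrow>
      act R (s * t) v = act R s (act R t v)"
    \<comment> \<open>\<^const>\<open>rho\<close>: a morphism of real Lie superalgebras from \<open>su(1|1)\<close> to \<open>End V\<close>\<close>
    and alg_linear: "X \<in> su11 \<Longrightarrow>
      linear_map_on (scl R) (scl R) (carrier R) (rho R X)"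
    and alg_add: "X \<in> su11 \<Longrightarrow> Y \<in> su11 \<Longrightarrow> v \<in> carrier R \<Longrightarrow>
      rho R (X + Y) v = rho R X v + rho R Y v"
    and alg_scaleR: "X \<in> su11 \<Longrightarrow> v \<in> carrier R \<Longrightarrow>
      rho R (a *\<^sub>R X) v = scl R (of_real a) (rho R X v)"
    and alg_even_even: "X \<in> su11_even \<Longrightarrow> rho R X ` ev R \<subseteq> ev R"
    and alg_even_odd: "X \<in> su11_even \<Longrightarrow> rho R X ` od R \<subseteq> od R"
    and alg_odd_even: "X \<in> su11_odd \<Longrightarrow> rho R X ` ev R \<subseteq> od R"
    and alg_odd_odd: "X \<in> su11_odd \<Longrightarrow> rho R X ` od R \<subseteq> ev R"
    and alg_commutator: "X \<in> su11_even \<Longrightarrow> Y \<in> su11 \<Longrightarrow> v \<in> carrier R \<Longrightarrow>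
      rho R (commutator X Y) v =
        rho R X (rho R Y v) - rho R Y (rho R X v)"
    and alg_anticommutator: "X \<in> su11_odd \<Longrightarrow> Y \<in> su11_odd \<Longrightarrow> v \<in> carrier R \<Longrightarrow>
      rho R (anticommutator X Y) v =
        rho R X (rho R Y v) + rho R Y (rho R X v)"
    \<comment> \<open>compatibility of the two actions; the adjoint action of the circle is trivial\<close>
    and alg_C: "v \<in> carrier R \<Longrightarrow> has_differential R v (rho R gen_C v)"
    and alg_grp: "t \<in> S1 \<Longrightarrow> X \<in> su11 \<Longrightarrow> v \<in> carrier R \<Longrightarrow>
      act R t (rho R X v) = rho R X (act R t v)"

definition is_isomorphism ::
  "('v::ab_group_add) su11_data \<Rightarrow> ('w::ab_group_add) su11_data \<Rightarrow> ('v \<Rightarrow> 'w) \<Rightarrow> bool" where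
  "is_isomorphism R R' f \<longleftrightarrow>
     bij_betw f (carrier R) (carrier R') \<and>
     linear_map_on (scl R) (scl R') (carrier R) f \<and>
     f ` ev R \<subseteq> ev R' \<and> f ` od R \<subseteq> od R' \<and>
     (\<forall>t\<in>S1. \<forall>v\<in>carrier R. f (act R t v) = act R' t (f v)) \<and>
     (\<forall>X\<in>su11. \<forall>v\<in>carrier R. f (rho R X v) = rho R' X (f v))"

definition isomorphic ::
  "('v::ab_group_add) su11_data \<Rightarrow> ('w::ab_group_add) su11_data \<Rightarrow> bool" where
  "isomorphic R R' \<longleftrightarrow> (\<exists>f. is_isomorphism R R' f)"


section \<open>Weight spaces\<close>

definition weight_space :: "('v::ab_group_add) su11_data \<Rightarrow> int \<Rightarrow> 'v set" where
  "weight_space R m =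
     {v \<in> carrier R. \<forall>t\<in>S1. act R t v = scl R (t powi m) v}"

definition finite_dimensional :: "('v::ab_group_add) su11_data \<Rightarrow> 'v set \<Rightarrow> bool" where
  "finite_dimensional R W \<longleftrightarrow>
     (\<exists>B. finite B \<and> W = module.span (scl R) B)"

definition weight_rep :: "('v::ab_group_add) su11_data \<Rightarrow> int \<Rightarrow> 'v su11_data" where
  "weight_rep R m = R\<lparr>ev := ev R \<inter> weight_space R m,
                      od := od R \<inter> weight_space R m\<rparr>"


section \<open>Direct sums\<close>

definition direct_sum2 ::
  "('v::ab_group_add) su11_data \<Rightarrow> ('w::ab_group_add) su11_data \<Rightarrow> ('v \<times> 'w) su11_data" where
  "direct_sum2 R R' =
     \<lparr>scl = (\<lambda>c (x, y). (scl R c x, scl R' c y)),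
      ev = ev R \<times> ev R',
      od = od R \<times> od R',
      act = (\<lambda>t (x, y). (act R t x, act R' t y)),
      rho = (\<lambda>X (x, y). (rho R X x, rho R' X y))\<rparr>"

text \<open>Finitely supported families \<open>x\<close> with \<open>x i\<close> in \<open>A i\<close> for \<open>i\<close> in \<open>I\<close>, extended by \<open>0\<close>.\<close>

definition finite_families :: "'i set \<Rightarrow> ('i \<Rightarrow> ('v::zero) set) \<Rightarrow> ('i \<Rightarrow> 'v) set" where
  "finite_families I A = {x. finite {i. x i \<noteq> 0} \<and> (\<forall>i\<in>I. x i \<in> A i) \<and> (\<forall>i. i \<notin> I \<longrightarrow> x i = 0)}"

definition direct_sum ::
  "'i set \<Rightarrow> ('i \<Rightarrow> ('v::ab_group_add) su11_data) \<Rightarrow> ('i \<Rightarrow> 'v) su11_data" where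
  "direct_sum I R =
     \<lparr>scl = (\<lambda>c x i. scl (R i) c (x i)),
      ev = finite_families I (\<lambda>i. ev (R i)),
      od = finite_families I (\<lambda>i. od (R i)),
      act = (\<lambda>t x i. if i \<in> I then act (R i) t (x i) else 0),
      rho = (\<lambda>X x i. if i \<in> I then rho (R i) X (x i) else 0)\<rparr>"


section \<open>Super weight spaces\<close>

text \<open>On \<open>\<complex>\<^sup>2\<close> the first coordinate is even and the second odd. The parameter \<open>\<sigma>\<close>
  is \<open>1\<close> for \<open>W\<^sub>m\<^sup>+\<close> and \<open>-1\<close> for \<open>W\<^sub>m\<^sup>-\<close>, and \<open>r\<close> is the chosen square root of
  \<open>-im\<close>. An element \<open>X\<close> of \<^const>\<open>su11\<close> is \<open>a C + b U + c S\<close> with real \<open>a = Im X\<^sub>1\<^sub>1\<close>,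
  \<open>b = Re X\<^sub>1\<^sub>2\<close> and \<open>c = Im X\<^sub>1\<^sub>2\<close>.\<close>

definition super_weight_matrix :: "complex \<Rightarrow> complex \<Rightarrow> int \<Rightarrow> complex^2^2 \<Rightarrow> complex^2^2" where
  "super_weight_matrix \<sigma> r m X =
     Im (X $ 1 $ 1) *\<^sub>R mat2 (\<i> * of_int m) 0 0 (\<i> * of_int m) +
     Re (X $ 1 $ 2) *\<^sub>R mat2 0 r r 0 +
     Im (X $ 1 $ 2) *\<^sub>R mat2 0 (- \<sigma> * of_int m / r) (\<sigma> * of_int m / r) 0"

definition super_weight :: "complex \<Rightarrow> complex \<Rightarrow> int \<Rightarrow> (complex^2) su11_data" where
  "super_weight \<sigma> r m =
     \<lparr>scl = (*s),
      ev = {v. v $ 2 = 0},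
      od = {v. v $ 1 = 0},
      act = (\<lambda>t v. t powi m *s v),
      rho = (\<lambda>X v. super_weight_matrix \<sigma> r m X *v v)\<rparr>"

abbreviation W_plus :: "complex \<Rightarrow> int \<Rightarrow> (complex^2) su11_data" where
  "W_plus r m \<equiv> super_weight 1 r m"
abbreviation W_minus :: "complex \<Rightarrow> int \<Rightarrow> (complex^2) su11_data" where
  "W_minus r m \<equiv> super_weight (- 1) r m"

lemma super_weight_matrix_generators:
  "super_weight_matrix \<sigma> r m gen_C = mat2 (\<i> * of_int m) 0 0 (\<i> * of_int m)"
  "super_weight_matrix \<sigma> r m gen_U = mat2 0 r r 0"
  "super_weight_matrix \<sigma> r m gen_S = mat2 0 (- \<sigma> * of_int m / r) (\<sigma> * of_int m / r) 0"
  by (simp_all add: super_weight_matrix_def gen_C_def gen_U_def gen_S_def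
      mat2_def vec_eq_iff forall_2)

text \<open>The index set of a direct sum in which the weight \<open>m \<noteq> 0\<close> occurs \<open>p m\<close> times.\<close>

definition multiplicity_index :: "(int \<Rightarrow> nat) \<Rightarrow> (int \<times> nat) set" where
  "multiplicity_index p = {(m, j). m \<noteq> 0 \<and> j < p m}"

end

(* A matrix coefficient of the circle action is differentiable at 0 for every linear functional
   whatsoever; this forces the orbit of each vector near 1 into a finite-dimensional subspace, since
   along infinitely many independent translates one could prescribe a discontinuous coefficient.
   Hence every vector is annihilated by a polynomial in C. Periodicity of the one-parameter group
   excludes nontrivial Jordan blocks of C and makes its eigenvalues i m, so the representation is the
   direct sum of its weight spaces. On a weight space with m nonzero, U U = S S = -i m makes U an
   isomorphism between the even and the odd part, and the even operator U S satisfies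
   (U S)^2 = m^2. An even vector x with U S x = m x (or -m x) spans together with U x a copy of
   W_m^+ (or W_m^-). *)

theory Submission
  imports Defs "HOL-Computational_Algebra.Fundamental_Theorem_Algebra"
begin

section \<open>Decomposition into weight spaces\<close>

text \<open>\<open>V\<close> has no topology and may be infinite-dimensional, so weight components
  cannot be produced by integrating over the circle. That every vector is a finite sum of weight
  vectors must come from differentiability alone; a vector with infinitely many Fourier modes is
  excluded because its translates near 1 span an infinite-dimensional space. Coefficients are scalar
  functions of a real variable, so an equation along an orbit is proved under each functional and
  read back by separation. \<open>U S\<close> is the operator to diagonalise because it preserves
  parity, which \<open>U\<close> and \<open>S\<close> do not: a basis of the even part then
  determines the odd part through \<open>U\<close>. The sign \<open>\<sigma>\<close> is that of the
  eigenvalue \<open>\<sigma> m\<close>, and the square of \<open>r m\<close> is the scalar by which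
  \<open>U U\<close> acts, so normalising the odd vector to \<open>U x / r m\<close> gives both
  off-diagonal entries of \<open>U\<close> the value \<open>r m\<close>. Finite-dimensional weight
  spaces yield finite bases of the eigenspaces, whose lengths are the multiplicities. The
  isomorphism is constructed from the model to \<open>V\<close>, where it is an explicit finite sum,
  and inverted at the end.\<close>

lemma constant_of_zero_derivative:
  fixes f :: "real \<Rightarrow> complex"
  assumes "\<And>x. (f has_vector_derivative 0) (at x)"
  shows "f x = f y"
  by (rule has_vector_derivative_zero_constant[OF convex_UNIV, of f]) (simp_all add: assms)

section \<open>Relations and bases in finite-dimensional spans\<close>

context vector_space
begin

text \<open>Coefficients are attached to indices rather than vectors, because the index will become
  the degree of a monomial in \<open>C\<close>. A repeated vector therefore already gives a
  relation, with coefficients 1 and -1; otherwise the bound on independent subsets of a finite span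
  applies.\<close>

lemma dependent_family:
  assumes "finite F" and "card F \<le> n" and f: "\<And>i. i \<le> n \<Longrightarrow> f i \<in> span F"
  obtains a where "\<exists>i\<le>n. a i \<noteq> 0" "(\<Sum>i\<le>n. scale (a i) (f i)) = 0"
proof (cases "inj_on f {..n}")
  case False
  then obtain i j where ij: "i \<le> n" "j \<le> n" "i \<noteq> j" "f i = f j"
    by (auto simp: inj_on_def)
  define a where "a k = (if k = i then 1 else if k = j then - 1 else (0::'a))" for k
  have "(\<Sum>k\<le>n. scale (a k) (f k)) = (\<Sum>k\<in>{i, j}. scale (a k) (f k))"
    by (rule sum.mono_neutral_right) (use ij in \<open>auto simp: a_def\<close>)
  also have "\<dots> = 0"
    using ij by (simp add: a_def)
  finally show thesis
    using ij(1) by (intro that[of a]) (auto simp: a_def)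
next
  case True
  have "dependent (f ` {..n})"
  proof (rule ccontr)
    assume "independent (f ` {..n})"
    then have "card (f ` {..n}) \<le> card F"
      using independent_span_bound[OF \<open>finite F\<close>] f by blast
    with True \<open>card F \<le> n\<close> show False
      by (simp add: card_image)
  qed
  then obtain u where u: "\<exists>v\<in>f ` {..n}. u v \<noteq> 0" "(\<Sum>v\<in>f ` {..n}. scale (u v) v) = 0"
    using dependent_finite[of "f ` {..n}"] by auto
  show thesis
  proof (rule that)
    show "\<exists>i\<le>n. (u \<circ> f) i \<noteq> 0"
      using u(1) by auto
    show "(\<Sum>i\<le>n. scale ((u \<circ> f) i) (f i)) = 0"
      using u(2) True by (simp add: sum.reindex)
  qed
qed

text \<open>The basis is enumerated by the numbers below \<open>n\<close> so that its members can
  label the copies \<open>(m, j)\<close> in the direct sum.\<close>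

lemma subspace_basis_family:
  assumes "finite F" "subspace W" "W \<subseteq> span F"
  obtains n and e :: "nat \<Rightarrow> 'b" where "\<And>j. j < n \<Longrightarrow> e j \<in> W"
    and "\<And>a. (\<Sum>j<n. scale (a j) (e j)) = 0 \<Longrightarrow> \<forall>j<n. a j = 0"
    and "\<And>v. v \<in> W \<Longrightarrow> \<exists>a. v = (\<Sum>j<n. scale (a j) (e j))"
proof -
  obtain B where B: "B \<subseteq> W" "independent B" "W \<subseteq> span B"
    by (rule maximal_independent_subset)
  then have fin: "finite B"
    using independent_span_bound[OF assms(1), of B] assms(3) by blast
  then obtain e where e: "bij_betw e {0..<card B} B"
    using ex_bij_betw_nat_finite by blast
  then have inj: "inj_on e {..<card B}" and img: "e ` {..<card B} = B"
    by (auto simp: bij_betw_def atLeast0LessThan)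
  have reindex: "(\<Sum>v\<in>B. scale (u v) v) = (\<Sum>j<card B. scale (u (e j)) (e j))" for u
    using sum.reindex[OF inj, of "\<lambda>v. scale (u v) v"] img by simp
  show thesis
  proof (rule that[of "card B" e])
    show "e j \<in> W" if "j < card B" for j
      using B(1) img that by blast
    show "\<forall>j<card B. a j = 0" if "(\<Sum>j<card B. scale (a j) (e j)) = 0" for a
    proof -
      have "(\<Sum>v\<in>B. scale (a (the_inv_into {..<card B} e v)) v) = 0"
        unfolding reindex using that inj by (simp add: the_inv_into_f_f)
      then have "a (the_inv_into {..<card B} e v) = 0" if "v \<in> B" for v
        using independentD[OF B(2) fin subset_refl, of "\<lambda>v. a (the_inv_into {..<card B} e v)"] that
        by blast
      then show ?thesis
        using img inj by (metis imageI lessThan_iff the_inv_into_f_f)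
    qed
    show "\<exists>a. v = (\<Sum>j<card B. scale (a j) (e j))" if "v \<in> W" for v
    proof -
      from that B(3) have "v \<in> span B" by blast
      then obtain u where "v = (\<Sum>v\<in>B. scale (u v) v)"
        by (auto simp: span_finite[OF fin])
      then show ?thesis
        by (auto simp: reindex)
    qed
  qed
qed

end

section \<open>Linearity on the carrier and complex functionals\<close>

sublocale su11_representation \<subseteq> vs: vector_space "scl R"
  by (rule vector_space)

context su11_representation
begin

abbreviation smul (infixr "\<cdot>" 75) where "c \<cdot> v \<equiv> scl R c v"
abbreviation V where "V \<equiv> carrier R"
abbreviation T where "T \<theta> \<equiv> act R (cis \<theta>)"
abbreviation C where "C \<equiv> rho R gen_C"
abbreviation functional where "functional \<equiv> Vector_Spaces.linear (scl R) ((*) :: complex \<Rightarrow> complex \<Rightarrow> complex)"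

lemma subspace_carrier: "vs.subspace V"
  unfolding carrier_def
  using vs.subspace_sums[OF subspace_even subspace_odd] by simp

lemmas V_add = vs.subspace_add[OF subspace_carrier]
  and V_diff = vs.subspace_diff[OF subspace_carrier]
  and V_scale = vs.subspace_scale[OF subspace_carrier]
  and V_zero = vs.subspace_0[OF subspace_carrier]
  and V_sum = vs.subspace_sum[OF subspace_carrier]

lemma ev_subset: "ev R \<subseteq> V" and od_subset: "od R \<subseteq> V"
  unfolding carrier_def
  using vs.subspace_0[OF subspace_even] vs.subspace_0[OF subspace_odd]
  by (force)+

lemma act_add: "t \<in> S1 \<Longrightarrow> v \<in> V \<Longrightarrow> w \<in> V \<Longrightarrow> act R t (v + w) = act R t v + act R t w"
  and act_scale: "t \<in> S1 \<Longrightarrow> v \<in> V \<Longrightarrow> act R t (c \<cdot> v) = c \<cdot> act R t v"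
  using grp_linear by (auto simp: linear_map_on_def)

lemma act_zero: "t \<in> S1 \<Longrightarrow> act R t 0 = 0"
  using act_scale[of t 0 0] V_zero by simp

lemma act_diff: "t \<in> S1 \<Longrightarrow> v \<in> V \<Longrightarrow> w \<in> V \<Longrightarrow> act R t (v - w) = act R t v - act R t w"
  using act_add[of t v "- 1 \<cdot> w"] act_scale[of t w "- 1"] V_scale[of w "- 1"] by simp

lemma rho_add: "X \<in> su11 \<Longrightarrow> v \<in> V \<Longrightarrow> w \<in> V \<Longrightarrow> rho R X (v + w) = rho R X v + rho R X w"
  and rho_scale: "X \<in> su11 \<Longrightarrow> v \<in> V \<Longrightarrow> rho R X (c \<cdot> v) = c \<cdot> rho R X v"
  using alg_linear by (auto simp: linear_map_on_def)

lemma rho_zero: "X \<in> su11 \<Longrightarrow> rho R X 0 = 0"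
  using rho_scale[of X 0 0] V_zero by simp

lemma rho_diff: "X \<in> su11 \<Longrightarrow> v \<in> V \<Longrightarrow> w \<in> V \<Longrightarrow> rho R X (v - w) = rho R X v - rho R X w"
  using rho_add[of X v "- 1 \<cdot> w"] rho_scale[of X w "- 1"] V_scale[of w "- 1"] by simp

lemma act_closed: "t \<in> S1 \<Longrightarrow> v \<in> V \<Longrightarrow> act R t v \<in> V"
proof -
  assume t: "t \<in> S1" and "v \<in> V"
  then obtain x y where xy: "x \<in> ev R" "y \<in> od R" "v = x + y"
    by (auto simp: carrier_def)
  then have "act R t v = act R t x + act R t y"
    using act_add[OF t] ev_subset od_subset by blast
  then show ?thesis
    using grp_even[OF t] grp_odd[OF t] xy unfolding carrier_def by blast
qed

lemma generators: "gen_C \<in> su11" "gen_U \<in> su11" "gen_S \<in> su11"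
  "gen_C \<in> su11_even" "gen_U \<in> su11_odd" "gen_S \<in> su11_odd"
  by (auto simp: su11_def su11_even_def su11_odd_def intro: span_base)

lemma C_even: "v \<in> ev R \<Longrightarrow> C v \<in> ev R" and C_odd: "v \<in> od R \<Longrightarrow> C v \<in> od R"
  using alg_even_even[OF generators(4)] alg_even_odd[OF generators(4)] by auto

lemma C_closed: assumes "v \<in> V" shows "C v \<in> V"
proof -
  from assms obtain x y where xy: "x \<in> ev R" "y \<in> od R" "v = x + y"
    by (auto simp: carrier_def)
  then have "C v = C x + C y"
    using rho_add[OF generators(1)] ev_subset od_subset by blast
  then show ?thesis
    using C_even C_odd xy unfolding carrier_def by blast
qed

lemma C_pow_closed: "v \<in> V \<Longrightarrow> (C ^^ n) v \<in> V"
  by (induction n) (auto simp: C_closed)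

lemma cis_S1 [simp]: "cis \<theta> \<in> S1"
  by simp

lemma functional_extend:
  assumes "vs.independent B"
  shows "\<exists>\<phi>. functional \<phi> \<and> (\<forall>x\<in>B. \<phi> x = f x)"
proof -
  have "vector_space ((*) :: complex \<Rightarrow> complex \<Rightarrow> complex)"
    by unfold_locales (auto simp: algebra_simps)
  then have "vector_space_pair (scl R) ((*) :: complex \<Rightarrow> complex \<Rightarrow> complex)"
    by (intro vector_space_pair.intro vector_space)
  from vector_space_pair.linear_independent_extend[OF this assms] show ?thesis .
qed

lemma functional_linear:
  assumes "functional \<phi>"
  shows "\<phi> (x + y) = \<phi> x + \<phi> y" "\<phi> (x - y) = \<phi> x - \<phi> y" "\<phi> (c \<cdot> x) = c * \<phi> x" "\<phi> 0 = 0"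
proof -
  interpret Vector_Spaces.linear "scl R" "(*) :: complex \<Rightarrow> complex \<Rightarrow> complex" \<phi> by fact
  show "\<phi> (x + y) = \<phi> x + \<phi> y" "\<phi> (x - y) = \<phi> x - \<phi> y" "\<phi> (c \<cdot> x) = c * \<phi> x" "\<phi> 0 = 0"
    by (simp_all add: add diff scale)
qed

text \<open>A basis of the span stays independent after adjoining \<open>v\<close>, so the values 0
  on the basis and 1 at \<open>v\<close> extend to a functional.\<close>

lemma separating_functional:
  assumes "v \<notin> vs.span F"
  obtains \<phi> where "functional \<phi>" "\<And>x. x \<in> vs.span F \<Longrightarrow> \<phi> x = 0" "\<phi> v = 1"
proof -
  obtain B where B: "B \<subseteq> F" "vs.independent B" "F \<subseteq> vs.span B"
    by (rule vs.maximal_independent_subset)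
  then have span: "vs.span B = vs.span F"
    by (metis vs.span_eq vs.span_superset subset_trans)
  then have "vs.independent (insert v B)"
    using B assms vs.independent_insert by auto
  then obtain \<phi> where \<phi>: "functional \<phi>" "\<forall>x\<in>insert v B. \<phi> x = (if x = v then 1 else 0)"
    using functional_extend[of "insert v B" "\<lambda>x. if x = v then 1 else 0"] by blast
  have "v \<notin> B"
    using assms span vs.span_base by blast
  then have "\<forall>x\<in>B. \<phi> x = 0"
    using \<phi>(2) by auto
  have "\<phi> x = 0" if "x \<in> vs.span B" for x
    using that \<open>\<forall>x\<in>B. \<phi> x = 0\<close>
    by (induction rule: vs.span_induct_alt) (auto simp: functional_linear[OF \<phi>(1)])
  with \<phi> span that show thesis by auto
qed

text \<open>Derivatives are only available coefficientwise; this turns their consequences back into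
  identities of vectors.\<close>

lemma functionals_separate:
  assumes "\<And>\<phi>. functional \<phi> \<Longrightarrow> \<phi> v = \<phi> w"
  shows "v = w"
proof (rule ccontr)
  assume "v \<noteq> w"
  then have "v - w \<notin> vs.span {}" by simp
  then obtain \<phi> where "functional \<phi>" "\<phi> (v - w) = 1"
    by (rule separating_functional)
  with assms[of \<phi>] show False
    using functional_linear(2)[of \<phi>] by simp
qed

section \<open>Orbits as solutions of differential equations\<close>

lemma T_add: "v \<in> V \<Longrightarrow> T (\<alpha> + \<beta>) v = T \<alpha> (T \<beta> v)"
  using grp_mult[of "cis \<alpha>" "cis \<beta>" v] by (simp add: cis_mult)

lemma T_C: "v \<in> V \<Longrightarrow> T \<theta> (C v) = C (T \<theta> v)"
  using alg_grp[of "cis \<theta>" gen_C v] generators by simp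

text \<open>The axiom speaks about \<open>\<theta> = 0\<close> only. Applying it to the vector
  \<open>T \<theta> v\<close> and using the group law moves it to every
  \<open>\<theta>\<close>.\<close>

lemma coefficient_derivative:
  assumes "v \<in> V" "functional \<phi>"
  shows "((\<lambda>\<theta>. \<phi> (T \<theta> v)) has_vector_derivative \<phi> (T \<theta> (C v))) (at \<theta>)"
proof -
  let ?f = "\<lambda>h. \<phi> (T h (T \<theta> v))"
  have "(?f has_vector_derivative \<phi> (C (T \<theta> v))) (at 0)"
    using alg_C[of "T \<theta> v"] assms act_closed[of "cis \<theta>" v] by (simp add: has_differential_def)
  then have "(?f has_vector_derivative \<phi> (C (T \<theta> v))) (at (\<theta> - \<theta>))"
    by simp
  moreover have "((\<lambda>x. x - \<theta>) has_vector_derivative 1) (at \<theta>)"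
    by (auto intro!: derivative_eq_intros)
  ultimately have "((?f \<circ> (\<lambda>x. x - \<theta>)) has_vector_derivative 1 *\<^sub>R \<phi> (C (T \<theta> v))) (at \<theta>)"
    by (intro vector_diff_chain_at)
  moreover have "?f \<circ> (\<lambda>x. x - \<theta>) = (\<lambda>x. \<phi> (T x v))"
    by (rule ext) (simp add: T_add[OF assms(1), symmetric])
  ultimately show ?thesis
    using T_C[OF assms(1)] by simp
qed

text \<open>The integrating factor \<open>exp (- c \<theta>)\<close> replaces \<open>C\<close> by
  \<open>C - c\<close>, so on (generalized) eigenvectors the right-hand side becomes trivial to
  integrate.\<close>

lemma twisted_derivative:
  assumes "v \<in> V" "functional \<phi>"
  shows "((\<lambda>\<theta>. exp (- c * of_real \<theta>) * \<phi> (T \<theta> v)) has_vector_derivative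
           exp (- c * of_real \<theta>) * \<phi> (T \<theta> (C v - c \<cdot> v))) (at \<theta>)"
proof -
  have "((\<lambda>\<theta>. exp (- c * of_real \<theta>)) has_vector_derivative - c * exp (- c * of_real \<theta>)) (at \<theta>)"
    by (rule has_vector_derivative_real_field) (auto intro!: derivative_eq_intros)
  from has_vector_derivative_mult[OF this coefficient_derivative[OF assms]]
  have "((\<lambda>\<theta>. exp (- c * of_real \<theta>) * \<phi> (T \<theta> v)) has_vector_derivative
           exp (- c * of_real \<theta>) * (\<phi> (T \<theta> (C v)) - c * \<phi> (T \<theta> v))) (at \<theta>)"
    by (simp add: algebra_simps)
  moreover have "T \<theta> (C v - c \<cdot> v) = T \<theta> (C v) - c \<cdot> T \<theta> v"
    using assms(1) by (simp add: act_diff act_scale C_closed V_scale)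
  ultimately show ?thesis
    by (simp add: functional_linear[OF assms(2)])
qed

lemma T_zero: "v \<in> V \<Longrightarrow> T 0 v = v"
  using grp_one by simp

lemma T_eigenvector:
  assumes "v \<in> V" "C v = c \<cdot> v"
  shows "T \<theta> v = exp (c * of_real \<theta>) \<cdot> v"
proof (rule functionals_separate)
  fix \<phi> assume \<phi>: "functional \<phi>"
  have "T \<theta> (C v - c \<cdot> v) = 0" for \<theta>
    using act_scale[of "cis \<theta>" 0 0] assms V_zero by simp
  then have "exp (- c * of_real \<theta>) * \<phi> (T \<theta> v) = exp (- c * of_real 0) * \<phi> (T 0 v)"
    using twisted_derivative[OF assms(1) \<phi>, of c] functional_linear[OF \<phi>]
    by (intro constant_of_zero_derivative) simp
  then show "\<phi> (T \<theta> v) = \<phi> (exp (c * of_real \<theta>) \<cdot> v)"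
    using assms by (simp add: grp_one[OF assms(1)] functional_linear[OF \<phi>] exp_minus field_simps)
qed

text \<open>Since \<open>T \<theta> u = exp (c \<theta>) u\<close>, the twisted coefficient of
  \<open>v\<close> has the constant derivative \<open>\<phi> u\<close>; subtracting
  \<open>\<theta> * \<phi> u\<close> leaves a constant.\<close>

lemma T_generalized_eigenvector:
  assumes "v \<in> V" "u \<in> V" "C v = c \<cdot> v + u" "C u = c \<cdot> u"
  shows "T \<theta> v = exp (c * of_real \<theta>) \<cdot> (v + of_real \<theta> \<cdot> u)"
proof (rule functionals_separate)
  fix \<phi> assume \<phi>: "functional \<phi>"
  have "((\<lambda>\<theta>. exp (- c * of_real \<theta>) * \<phi> (T \<theta> v)) has_vector_derivative \<phi> u) (at \<theta>)" for \<theta>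
    using twisted_derivative[OF assms(1) \<phi>, of c \<theta>] T_eigenvector[OF assms(2,4)] assms(3)
    by (simp add: functional_linear[OF \<phi>] exp_minus flip: mult.assoc)
  moreover have "((\<lambda>\<theta>. of_real \<theta> * \<phi> u) has_vector_derivative \<phi> u) (at \<theta>)" for \<theta>
    by (rule has_vector_derivative_real_field) (auto intro!: derivative_eq_intros)
  ultimately have "((\<lambda>\<theta>. exp (- c * of_real \<theta>) * \<phi> (T \<theta> v) - of_real \<theta> * \<phi> u)
      has_vector_derivative 0) (at \<theta>)" for \<theta>
    using has_vector_derivative_diff by fastforce
  then have "exp (- c * of_real \<theta>) * \<phi> (T \<theta> v) - of_real \<theta> * \<phi> u =
    exp (- c * of_real 0) * \<phi> (T 0 v) - of_real 0 * \<phi> u"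
    by (rule constant_of_zero_derivative)
  then have "exp (- c * of_real \<theta>) * \<phi> (T \<theta> v) = \<phi> v + of_real \<theta> * \<phi> u"
    by (simp add: grp_one[OF assms(1)] diff_eq_eq)
  then show "\<phi> (T \<theta> v) = \<phi> (exp (c * of_real \<theta>) \<cdot> (v + of_real \<theta> \<cdot> u))"
    by (simp add: functional_linear[OF \<phi>] exp_minus field_simps)
qed

text \<open>\<open>T (2 * pi)\<close> is the identity, but it multiplies an eigenvector by
  \<open>exp (2 * pi * c)\<close>.\<close>

lemma eigenvector_exp:
  assumes "v \<in> V" "C v = c \<cdot> v" "v \<noteq> 0"
  shows "exp (of_real (2 * pi) * c) = 1"
proof -
  have "cis (2 * pi) = 1" by simp
  then have "exp (c * of_real (2 * pi)) \<cdot> v = v"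
    using T_eigenvector[OF assms(1,2), of "2 * pi"] grp_one[OF assms(1)] by metis
  then have "(exp (c * of_real (2 * pi)) - 1) \<cdot> v = 0"
    by (simp add: vs.scale_left_diff_distrib)
  with assms(3) have "exp (c * of_real (2 * pi)) = 1"
    by (metis eq_iff_diff_eq_0 vs.scale_eq_0_iff)
  then show ?thesis
    by (simp only: mult.commute)
qed

text \<open>A Jordan block would make orbits grow linearly: at \<open>2 * pi\<close> the vector
  \<open>v\<close> would return as \<open>v + 2 * pi * u\<close>, contradicting periodicity.\<close>

lemma no_generalized_eigenvector:
  assumes "v \<in> V" "u \<in> V" "C v = c \<cdot> v + u" "C u = c \<cdot> u"
  shows "u = 0"
proof (rule ccontr)
  assume "u \<noteq> 0"
  then have "exp (of_real (2 * pi) * c) = 1"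
    using eigenvector_exp assms by blast
  moreover have "cis (2 * pi) = 1" by simp
  ultimately have "v + of_real (2 * pi) \<cdot> u = v"
    using T_generalized_eigenvector[OF assms, of "2 * pi"] grp_one[OF assms(1)]
    by (metis mult.commute vs.scale_one)
  with \<open>u \<noteq> 0\<close> show False by simp
qed

section \<open>Eigenvalues of \<open>C\<close>, weights, and local finiteness of orbits\<close>

lemma cis_powi_exp: "cis \<theta> powi m = exp (\<i> * of_int m * of_real \<theta>)"
  unfolding cis_power_int unfolding cis_conv_exp
  by (simp only: of_real_mult of_real_of_int_eq mult.assoc)

text \<open>\<open>exp (2 * pi * c) = 1\<close> forces \<open>c\<close> into \<open>\<i>\<close>
  times the integers, and every point of the circle is \<open>cis\<close> of its argument, so the
  formula for \<open>T\<close> determines the whole group action.\<close>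

lemma eigenvector_weight:
  assumes "v \<in> V" "C v = c \<cdot> v" "v \<noteq> 0"
  obtains m where "c = \<i> * of_int m" "v \<in> weight_space R m"
proof -
  from eigenvector_exp[OF assms] obtain n :: int
    where n: "Re (of_real (2 * pi) * c) = 0" "Im (of_real (2 * pi) * c) = of_int (2 * n) * pi"
    by (auto simp: exp_eq_1)
  then have c: "c = \<i> * of_int n"
    by (simp add: complex_eq_iff)
  have "act R t v = (t powi n) \<cdot> v" if "t \<in> S1" for t
  proof -
    from that have "t = cis (Arg t)"
      using cis_Arg[of t] by (cases "t = 0") (auto simp: sgn_eq)
    moreover have "T (Arg t) v = (cis (Arg t) powi n) \<cdot> v"
      unfolding cis_powi_exp T_eigenvector[OF assms(1,2)] c ..
    ultimately show ?thesis by metis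
  qed
  with c assms(1) show thesis
    by (intro that) (auto simp: weight_space_def)
qed

text \<open>Each coefficient has two derivatives at 0, one from the differential of the action and
  one from the explicit exponential; they coincide by uniqueness.\<close>

lemma weight_C:
  assumes "v \<in> weight_space R m"
  shows "C v = (\<i> * of_int m) \<cdot> v"
proof (rule functionals_separate)
  fix \<phi> assume \<phi>: "functional \<phi>"
  from assms have v: "v \<in> V" and act: "\<And>t. t \<in> S1 \<Longrightarrow> act R t v = (t powi m) \<cdot> v"
    by (auto simp: weight_space_def)
  have "((\<lambda>\<theta>. \<phi> (T \<theta> v)) has_vector_derivative \<phi> (C v)) (at 0)"
    using coefficient_derivative[OF v \<phi>, of 0] T_zero[OF C_closed[OF v]] by simp
  moreover have "T \<theta> v = exp (\<i> * of_int m * of_real \<theta>) \<cdot> v" for \<theta>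
    unfolding act[OF cis_S1] cis_powi_exp ..
  then have "(\<lambda>\<theta>. \<phi> (T \<theta> v)) = (\<lambda>\<theta>. exp (\<i> * of_int m * of_real \<theta>) * \<phi> v)"
    by (simp add: functional_linear[OF \<phi>])
  moreover have "((\<lambda>\<theta>. exp (\<i> * of_int m * of_real \<theta>) * \<phi> v) has_vector_derivative
      \<i> * of_int m * \<phi> v) (at 0)"
    by (rule has_vector_derivative_real_field) (auto intro!: derivative_eq_intros)
  ultimately show "\<phi> (C v) = \<phi> ((\<i> * of_int m) \<cdot> v)"
    using vector_derivative_unique_at by (fastforce simp: functional_linear[OF \<phi>])
qed

lemma subspace_weight_space: "vs.subspace (weight_space R m)"
proof (rule vs.subspaceI)
  show "0 \<in> weight_space R m"
    unfolding weight_space_def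
    by (intro CollectI conjI ballI V_zero) (simp only: act_zero vs.scale_zero_right)
  show "x + y \<in> weight_space R m" if "x \<in> weight_space R m" "y \<in> weight_space R m" for x y
    using that by (simp add: weight_space_def V_add act_add vs.scale_right_distrib)
  show "c \<cdot> x \<in> weight_space R m" if "x \<in> weight_space R m" for c x
    using that by (simp add: weight_space_def V_scale act_scale vs.scale_left_commute)
qed

text \<open>A functional that vanishes at \<open>v\<close> and equals \<open>1\<close> along a linearly independent sequence
  \<open>T (h n) v\<close> with \<open>h n \<longlonglongrightarrow> 0\<close> would have a discontinuous matrix coefficient.\<close>

lemma locally_finite_orbit:
  assumes v: "v \<in> V"
  obtains \<epsilon> F where "\<epsilon> > 0" "finite F" "\<And>\<theta>. \<bar>\<theta>\<bar> < \<epsilon> \<Longrightarrow> T \<theta> v \<in> vs.span F"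
proof (rule ccontr)
  assume "\<not> thesis"
  with that have ex: "\<exists>\<theta>. \<bar>\<theta>\<bar> < \<epsilon> \<and> T \<theta> v \<notin> vs.span F" if "\<epsilon> > 0" "finite F" for \<epsilon> F
    using that by blast
  let ?B = "\<lambda>h n. insert v ((\<lambda>k. T (h k) v) ` {..<n})"
  \<comment> \<open>Recursive choice: the condition on \<open>h n\<close> refers only to earlier
    values. Keeping \<open>v\<close> itself in \<open>?B\<close> lets a functional take the value 0
    at \<open>v\<close> independently of its values on the orbit points; the bound
    \<open>1 / Suc n\<close> forces \<open>h\<close> to tend to 0.\<close>
  have "\<exists>h. \<forall>n. \<bar>h n\<bar> < 1 / real (Suc n) \<and> T (h n) v \<notin> vs.span (?B h n)"
  proof (rule dependent_wellorder_choice)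
    fix r :: real and f g :: "nat \<Rightarrow> real" and n
    assume "\<And>k. k < n \<Longrightarrow> f k = g k"
    then have "?B f n = ?B g n" by auto
    then show "(\<bar>r\<bar> < 1 / real (Suc n) \<and> T r v \<notin> vs.span (?B f n)) =
      (\<bar>r\<bar> < 1 / real (Suc n) \<and> T r v \<notin> vs.span (?B g n))" by simp
  next
    fix n and f :: "nat \<Rightarrow> real"
    show "\<exists>r. \<bar>r\<bar> < 1 / real (Suc n) \<and> T r v \<notin> vs.span (?B f n)"
      by (rule ex) auto
  qed
  then obtain h where h: "\<And>n. \<bar>h n\<bar> < 1 / real (Suc n)" "\<And>n. T (h n) v \<notin> vs.span (?B h n)"
    by blast
  have "v \<noteq> 0"
  proof
    assume "v = 0"
    then have "T (h 0) v = 0"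
      using act_scale[of "cis (h 0)" 0 0] V_zero by simp
    with h(2)[of 0] show False
      using vs.span_zero by simp
  qed
  have ind: "vs.independent (?B h n)" for n
  proof (induction n)
    case 0
    with \<open>v \<noteq> 0\<close> show ?case by (simp add: vs.independent_insert)
  next
    case (Suc n)
    have "?B h (Suc n) = insert (T (h n) v) (?B h n)"
      by (auto simp: lessThan_Suc)
    with Suc h(2)[of n] show ?case
      by (simp add: vs.independent_insert)
  qed
  have "vs.independent (\<Union>n. ?B h n)"
  proof (rule vs.independent_Union_directed)
    show "c \<subseteq> d \<or> d \<subseteq> c" if "c \<in> range (?B h)" "d \<in> range (?B h)" for c d
    proof -
      from that obtain i j where "c = ?B h i" "d = ?B h j" by blast
      then show ?thesis
        by (cases "i \<le> j") (auto intro!: imageI)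
    qed
  qed (use ind in auto)
  then obtain \<phi> where \<phi>: "functional \<phi>"
    "\<forall>x\<in>(\<Union>n. ?B h n). \<phi> x = (if x = v then 0 else 1)"
    using functional_extend[of "\<Union>n. ?B h n" "\<lambda>x. if x = v then 0 else 1"] by blast
  have "T (h n) v \<noteq> v" for n
    using h(2)[of n] vs.span_base[of v "?B h n"] by auto
  moreover have "T (h n) v \<in> (\<Union>n. ?B h n)" for n
    by (rule UN_I[of "Suc n"]) auto
  ultimately have \<phi>1: "\<phi> (T (h n) v) = 1" for n
    using bspec[OF \<phi>(2), of "T (h n) v"] by presburger
  have \<phi>0: "\<phi> (T 0 v) = 0"
    using \<phi>(2) T_zero[OF v] by simp
  have "isCont (\<lambda>\<theta>. \<phi> (T \<theta> v)) 0"
    using coefficient_derivative[OF v \<phi>(1)] has_vector_derivative_continuous by blast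
  moreover have "h \<longlonglongrightarrow> 0"
    using h(1) by (intro tendsto_rabs_zero_cancel[OF tendsto_sandwich[OF _ _ tendsto_const LIMSEQ_Suc[OF lim_1_over_n]]])
      (auto intro!: always_eventually less_imp_le)
  ultimately have "(\<lambda>n. \<phi> (T (h n) v)) \<longlonglongrightarrow> \<phi> (T 0 v)"
    by (rule isCont_tendsto_compose)
  then show False
    unfolding \<phi>0 \<phi>1 by (simp add: LIMSEQ_const_iff)
qed

text \<open>A functional that vanishes on the span containing the orbit near 0 has a vanishing
  coefficient there, hence so do all derivatives of that coefficient. These derivatives at 0 are the
  values at the iterates of \<open>C\<close> on \<open>v\<close>, so no iterate can be separated
  from the span.\<close>

lemma C_orbit_finite:
  assumes v: "v \<in> V"
  obtains F where "finite F" "\<And>n. (C ^^ n) v \<in> vs.span F"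
proof -
  obtain \<epsilon> F where F: "\<epsilon> > 0" "finite F" "\<And>\<theta>. \<bar>\<theta>\<bar> < \<epsilon> \<Longrightarrow> T \<theta> v \<in> vs.span F"
    using locally_finite_orbit[OF v] by metis
  have "(C ^^ n) v \<in> vs.span F" for n
  proof (rule ccontr)
    assume "(C ^^ n) v \<notin> vs.span F"
    then obtain \<phi> where \<phi>: "functional \<phi>" "\<And>x. x \<in> vs.span F \<Longrightarrow> \<phi> x = 0" "\<phi> ((C ^^ n) v) = 1"
      by (rule separating_functional) blast
    \<comment> \<open>The claim is kept for the whole interval, not just for 0, since the next
      derivative needs vanishing in a neighbourhood.\<close>
    have "\<phi> (T \<theta> ((C ^^ k) v)) = 0" if "\<bar>\<theta>\<bar> < \<epsilon>" for k \<theta>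
      using that
    proof (induction k arbitrary: \<theta>)
      case 0
      then show ?case using F \<phi> by simp
    next
      case (Suc k)
      have "((\<lambda>\<theta>. \<phi> (T \<theta> ((C ^^ k) v))) has_vector_derivative \<phi> (T \<theta> (C ((C ^^ k) v)))) (at \<theta>)"
        by (rule coefficient_derivative[OF C_pow_closed[OF v] \<phi>(1)])
      moreover have "((\<lambda>\<theta>. \<phi> (T \<theta> ((C ^^ k) v))) has_vector_derivative 0) (at \<theta>)"
        by (rule has_vector_derivative_transform_within_open[of "\<lambda>_. 0" 0 \<theta> "{-\<epsilon><..<\<epsilon>}"])
          (use Suc in auto)
      ultimately show ?case
        using vector_derivative_unique_at by fastforce
    qed
    from this[of 0 n] F(1) \<phi>(3) T_zero[OF C_pow_closed[OF v]] show False
      by simp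
  qed
  with F(2) that show thesis by blast
qed

section \<open>The span of the weight spaces\<close>

definition weight_sum where "weight_sum = vs.span (\<Union>m. weight_space R m)"

lemma weight_subset: "weight_space R m \<subseteq> V"
  by (auto simp: weight_space_def)

lemma weight_sum_subset: "weight_sum \<subseteq> V"
  unfolding weight_sum_def
  by (intro vs.span_minimal subspace_carrier) (use weight_subset in blast)

lemma eigenvector_weight_sum: "v \<in> V \<Longrightarrow> C v = c \<cdot> v \<Longrightarrow> v \<in> weight_sum"
  unfolding weight_sum_def
  by (cases "v = 0") (auto simp: vs.span_zero elim!: eigenvector_weight intro: vs.span_base)

text \<open>Modulo the image of \<open>C - c\<close>, a sum of weight vectors is an eigenvector for
  \<open>c\<close>: on weight \<open>m\<close> the operator \<open>C - c\<close> is the scalar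
  \<open>\<i> m - c\<close>, which is either invertible or zero.\<close>

lemma weight_sum_solve:
  assumes "u \<in> weight_sum"
  shows "u \<in> V \<and> (\<exists>w\<in>weight_sum. C (u - (C w - c \<cdot> w)) = c \<cdot> (u - (C w - c \<cdot> w)))"
  using assms unfolding weight_sum_def
proof (induction rule: vs.span_induct_alt)
  case base
  show ?case
    by (rule conjI[OF V_zero bexI[of _ 0]])  (simp_all add: rho_zero generators vs.span_zero V_zero)
next
  case (step a x y)
  then obtain m where x: "x \<in> weight_space R m" by blast
  from step.IH obtain w where w: "w \<in> weight_sum"
    "C (y - (C w - c \<cdot> w)) = c \<cdot> (y - (C w - c \<cdot> w))"
    unfolding weight_sum_def by blast
  have V: "x \<in> V" "y \<in> V" "w \<in> V"
    using x w step.IH weight_subset weight_sum_subset by blast+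
  note Cx = weight_C[OF x]
  \<comment> \<open>If \<open>c \<noteq> \<i> m\<close>, this \<open>b\<close> solves
    \<open>b * (\<i> m - c) = a\<close> and \<open>?z\<close> vanishes. Otherwise the value 0 leaves
    \<open>?z = a x\<close>, already an eigenvector for \<open>c\<close>.\<close>
  define b where "b = (if c = \<i> * of_int m then 0 else a / (\<i> * of_int m - c))"
  let ?z = "a \<cdot> x - b \<cdot> (C x - c \<cdot> x)" 
  have z: "?z = (a - b * (\<i> * of_int m - c)) \<cdot> x"
    by (simp add: Cx vs.scale_left_diff_distrib vs.scale_right_diff_distrib right_diff_distrib)
  have Cz: "C ?z = c \<cdot> ?z"
    unfolding z by (subst rho_scale[OF generators(1) V(1)]) (simp add: b_def Cx)
  have "a \<cdot> x + y - (C (b \<cdot> x + w) - c \<cdot> (b \<cdot> x + w)) = ?z + (y - (C w - c \<cdot> w))"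
    by (simp add: rho_add rho_scale generators V V_scale vs.scale_right_distrib vs.scale_right_diff_distrib mult.commute)
  moreover have "C (?z + (y - (C w - c \<cdot> w))) = c \<cdot> (?z + (y - (C w - c \<cdot> w)))"
    by (subst rho_add) (simp_all add: generators V V_scale V_diff C_closed Cz w vs.scale_right_distrib)
  moreover have "b \<cdot> x + w \<in> vs.span (\<Union>m. weight_space R m)"
    using w(1) step.hyps unfolding weight_sum_def
    by (intro vs.span_add vs.span_scale) (auto intro: vs.span_base)
  moreover have "a \<cdot> x + y \<in> V"
    using V by (intro V_add V_scale)
  ultimately show ?case by metis
qed

text \<open>After correcting \<open>v\<close> by a suitable \<open>w\<close>, the vector
  \<open>(C - c) (v - w)\<close> is itself an eigenvector for \<open>c\<close>. It is then the top
  of a Jordan block and must be zero, so \<open>v - w\<close> is an eigenvector.\<close>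

lemma weight_sum_shift:
  assumes "v \<in> V" "C v - c \<cdot> v \<in> weight_sum"
  shows "v \<in> weight_sum"
proof -
  from weight_sum_solve[OF assms(2)] obtain w where w: "w \<in> weight_sum"
    and eig: "C (C v - c \<cdot> v - (C w - c \<cdot> w)) = c \<cdot> (C v - c \<cdot> v - (C w - c \<cdot> w))"
    by blast
  let ?u = "C v - c \<cdot> v - (C w - c \<cdot> w)"
  have V: "w \<in> V"
    using w weight_sum_subset by blast
  have "C (v - w) = c \<cdot> (v - w) + ?u"
    by (simp add: rho_diff generators assms V vs.scale_right_diff_distrib)
  moreover from this have "?u = 0"
    using eig assms V by (intro no_generalized_eigenvector[of "v - w"]) (auto intro: V_diff V_scale C_closed)
  ultimately have "v - w \<in> weight_sum"
    using assms V by (intro eigenvector_weight_sum[of _ c]) (auto intro: V_diff)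
  from this w have "(v - w) + w \<in> weight_sum"
    unfolding weight_sum_def by (rule vs.span_add)
  then show ?thesis by simp
qed

section \<open>Polynomials in \<open>C\<close>\<close>

definition poly_C :: "complex poly \<Rightarrow> 'v \<Rightarrow> 'v" where
  "poly_C p v = (\<Sum>i\<le>degree p. coeff p i \<cdot> (C ^^ i) v)"

lemma poly_C_bound: "degree p \<le> n \<Longrightarrow> poly_C p v = (\<Sum>i\<le>n. coeff p i \<cdot> (C ^^ i) v)"
  unfolding poly_C_def by (rule sum.mono_neutral_left) (auto simp: coeff_eq_0)

lemma C_pow_diff: "v \<in> V \<Longrightarrow> w \<in> V \<Longrightarrow> (C ^^ n) (v - w) = (C ^^ n) v - (C ^^ n) w"
  and C_pow_scale: "v \<in> V \<Longrightarrow> (C ^^ n) (c \<cdot> v) = c \<cdot> (C ^^ n) v"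
  by (induction n) (auto simp: rho_diff rho_scale generators C_pow_closed)

text \<open>The factor \<open>C - c\<close> is moved inside, next to \<open>v\<close>, so that an
  induction on the degree can replace \<open>v\<close> by \<open>C v - c v\<close>.\<close>

lemma poly_C_linear_factor:
  assumes "v \<in> V"
  shows "poly_C ([:- c, 1:] * q) v = poly_C q (C v - c \<cdot> v)"
proof -
  let ?n = "degree q"
  have deg: "degree ([:- c, 1:] * q) \<le> Suc ?n"
    using degree_mult_le[of "[:- c, 1:]" q] by simp
  \<comment> \<open>Multiplication by the variable shifts coefficients by one; the separate value at
    index 0 guards against \<open>0 - 1 = 0\<close> on the naturals.\<close>
  have coeff: "coeff ([:- c, 1:] * q) i = (if i = 0 then 0 else coeff q (i - 1)) - c * coeff q i" for i
    by (cases i) (auto simp: coeff_pCons)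
  have "poly_C ([:- c, 1:] * q) v =
    (\<Sum>i\<le>Suc ?n. (if i = 0 then 0 else coeff q (i - 1)) \<cdot> (C ^^ i) v) -
    (\<Sum>i\<le>Suc ?n. (c * coeff q i) \<cdot> (C ^^ i) v)"
    unfolding poly_C_bound[OF deg] coeff
    by (simp add: vs.scale_left_diff_distrib sum_subtractf del: sum.atMost_Suc)
  also have "(\<Sum>i\<le>Suc ?n. (if i = 0 then 0 else coeff q (i - 1)) \<cdot> (C ^^ i) v) =
    (\<Sum>i\<le>?n. coeff q i \<cdot> (C ^^ i) (C v))"
    by (subst sum.atMost_Suc_shift) (simp add: funpow_swap1)
  also have "(\<Sum>i\<le>Suc ?n. (c * coeff q i) \<cdot> (C ^^ i) v) = (\<Sum>i\<le>?n. coeff q i \<cdot> (C ^^ i) (c \<cdot> v))"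
    using C_pow_scale[OF assms] by (simp add: coeff_eq_0 mult.commute)
  finally show ?thesis
    unfolding poly_C_def
    by (simp add: C_pow_diff assms C_closed V_scale vs.scale_right_diff_distrib sum_subtractf)
qed

text \<open>A root \<open>c\<close> of \<open>p\<close> splits off a linear factor. The induction
  hypothesis for the cofactor applies to \<open>C v - c v\<close>, and
  \<open>weight_sum_shift\<close> passes from there to \<open>v\<close>.\<close>

lemma poly_C_weight_sum:
  assumes "p \<noteq> 0" "v \<in> V" "poly_C p v \<in> weight_sum"
  shows "v \<in> weight_sum"
  using assms
proof (induction "degree p" arbitrary: p v)
  case 0
  then obtain a where p: "p = [:a:]" "a \<noteq> 0"
    by (metis degree_eq_zeroE pCons_0_0)
  with 0 have "a \<cdot> v \<in> weight_sum"
    by (simp add: poly_C_def)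
  from vs.span_scale[OF this[unfolded weight_sum_def], of "inverse a"] p show ?case
    by (simp add: weight_sum_def)
next
  case (Suc n)
  then have "\<not> constant (poly p)"
    by (simp add: constant_degree)
  then obtain c where "poly p c = 0"
    using fundamental_theorem_of_algebra by blast
  then obtain q where q: "p = [:- c, 1:] * q"
    by (auto simp: poly_eq_0_iff_dvd)
  with Suc.prems(1) have "q \<noteq> 0" by auto
  then have "degree p = Suc (degree q)"
    unfolding q by (subst degree_mult_eq) auto
  with Suc.hyps(2) have "n = degree q" by simp
  moreover have "C v - c \<cdot> v \<in> V"
    using Suc.prems by (auto intro: V_diff V_scale C_closed)
  ultimately have "C v - c \<cdot> v \<in> weight_sum"
    using Suc.hyps(1)[of q "C v - c \<cdot> v"] Suc.prems \<open>q \<noteq> 0\<close>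
    unfolding q poly_C_linear_factor[OF Suc.prems(2)] by simp
  with Suc.prems(2) show ?case
    by (rule weight_sum_shift)
qed

lemma carrier_eq_weight_sum: "V = weight_sum"
proof
  show "V \<subseteq> weight_sum"
  proof
    fix v assume v: "v \<in> V"
    obtain F where F: "finite F" "\<And>n. (C ^^ n) v \<in> vs.span F"
      using C_orbit_finite[OF v] by metis
    obtain a where a: "\<exists>i\<le>card F. a i \<noteq> 0" "(\<Sum>i\<le>card F. a i \<cdot> (C ^^ i) v) = 0"
      using vs.dependent_family[OF F(1) order_refl, of "\<lambda>i. (C ^^ i) v"] F(2) by blast
    \<comment> \<open>The relation among the \<open>card F + 1\<close> iterates of \<open>C\<close>
      on \<open>v\<close>, read as a nonzero polynomial that annihilates \<open>v\<close>.\<close>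
    define p where "p = (\<Sum>i\<le>card F. monom (a i) i)"
    have coeff: "coeff p i = (if i \<le> card F then a i else 0)" for i
      by (simp add: p_def coeff_sum)
    from a(1) coeff have "p \<noteq> 0" by (metis coeff_0)
    moreover have "degree p \<le> card F"
      by (rule degree_le) (simp add: coeff)
    then have "poly_C p v = 0"
      using a(2) by (simp add: poly_C_bound coeff)
    ultimately show "v \<in> weight_sum"
      using poly_C_weight_sum[OF _ v] by (simp add: weight_sum_def vs.span_zero)
  qed
qed (rule weight_sum_subset)

end

section \<open>Splitting off super weight spaces\<close>

text \<open>The first row of a matrix determines its real coordinates. These are the same entries
  that \<open>super_weight_matrix\<close> reads, so intertwining reduces to the three
  generators.\<close>

lemma su11_expand:
  assumes "X \<in> su11"
  shows "X = Im (X $ 1 $ 1) *\<^sub>R gen_C + (Re (X $ 1 $ 2) *\<^sub>R gen_U + Im (X $ 1 $ 2) *\<^sub>R gen_S)"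
proof -
  from assms obtain a b c where "X - a *\<^sub>R gen_C - b *\<^sub>R gen_U - c *\<^sub>R gen_S = 0"
    unfolding su11_def span_breakdown_eq by auto
  then have X: "X = a *\<^sub>R gen_C + (b *\<^sub>R gen_U + c *\<^sub>R gen_S)"
    by (simp add: algebra_simps)
  then have "Im (X $ 1 $ 1) = a" "Re (X $ 1 $ 2) = b" "Im (X $ 1 $ 2) = c"
    by (simp_all add: gen_C_def gen_U_def gen_S_def mat2_def)
  with X show ?thesis by simp
qed

section \<open>Carriers of the model direct sums\<close>

lemma carrier_direct_sum2: "carrier (direct_sum2 A B) = carrier A \<times> carrier B"
proof
  show "carrier (direct_sum2 A B) \<subseteq> carrier A \<times> carrier B"
    by (auto simp: carrier_def direct_sum2_def)
  show "carrier A \<times> carrier B \<subseteq> carrier (direct_sum2 A B)"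
  proof clarify
    fix a b assume "a \<in> carrier A" "b \<in> carrier B"
    then obtain x y x' y' where "x \<in> ev A" "y \<in> od A" "x' \<in> ev B" "y' \<in> od B"
      and ab: "a = x + y" "b = x' + y'"
      by (auto simp: carrier_def)
    then have "(x, x') \<in> ev (direct_sum2 A B)" "(y, y') \<in> od (direct_sum2 A B)"
      by (auto simp: direct_sum2_def)
    moreover have "(a, b) = (x, x') + (y, y')"
      by (simp add: ab)
    ultimately show "(a, b) \<in> carrier (direct_sum2 A B)"
      unfolding carrier_def by blast
  qed
qed

text \<open>The sign is kept as a parameter so that the sums of the \<open>W_plus\<close> and of the
  \<open>W_minus\<close> are treated together.\<close>

definition super_weight_sum ::
  "(int \<times> nat) set \<Rightarrow> complex \<Rightarrow> (int \<Rightarrow> complex) \<Rightarrow> (int \<times> nat \<Rightarrow> complex^2) su11_data" where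
  "super_weight_sum I \<sigma> r = direct_sum I (\<lambda>(m, j). super_weight \<sigma> (r m) m)"

definition supported :: "'i set \<Rightarrow> ('i \<Rightarrow> 'a::zero) set" where
  "supported I = {x. finite {i. x i \<noteq> 0} \<and> {i. x i \<noteq> 0} \<subseteq> I}"

lemma super_weight_sum_simps:
  "scl (super_weight_sum I \<sigma> r) c x i = c *s x i"
  "act (super_weight_sum I \<sigma> r) t x i = (if i \<in> I then t powi fst i *s x i else 0)"
  "rho (super_weight_sum I \<sigma> r) X x i =
     (if i \<in> I then super_weight_matrix \<sigma> (r (fst i)) (fst i) X *v x i else 0)"
  "ev (super_weight_sum I \<sigma> r) = {x \<in> supported I. \<forall>i. x i $ 2 = 0}"
  "od (super_weight_sum I \<sigma> r) = {x \<in> supported I. \<forall>i. x i $ 1 = 0}"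
  by (auto simp: super_weight_sum_def direct_sum_def super_weight_def finite_families_def
      supported_def split_beta)

lemma supported_add: "x \<in> supported I \<Longrightarrow> y \<in> supported I \<Longrightarrow> x + y \<in> supported I"
  for x y :: "'i \<Rightarrow> 'a::monoid_add"
proof -
  have "{i. (x + y) i \<noteq> 0} \<subseteq> {i. x i \<noteq> 0} \<union> {i. y i \<noteq> 0}"
    by auto
  moreover assume "x \<in> supported I" "y \<in> supported I"
  then have "finite ({i. x i \<noteq> 0} \<union> {i. y i \<noteq> 0})" "{i. x i \<noteq> 0} \<union> {i. y i \<noteq> 0} \<subseteq> I"
    by (simp_all add: supported_def)
  ultimately show "x + y \<in> supported I"
    unfolding supported_def using finite_subset subset_trans by blast
qed

lemma supported_mono:
  assumes "x \<in> supported I" "\<And>i. x i = 0 \<Longrightarrow> y i = 0"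
  shows "y \<in> supported I"
proof -
  have "{i. y i \<noteq> 0} \<subseteq> {i. x i \<noteq> 0}"
    using assms(2) by blast
  with assms(1) show ?thesis
    unfolding supported_def using finite_subset by blast
qed

lemma supported_super_weight_sum:
  assumes "x \<in> supported I"
  shows "scl (super_weight_sum I \<sigma> r) c x \<in> supported I"
    and "act (super_weight_sum I \<sigma> r) t x \<in> supported I"
    and "rho (super_weight_sum I \<sigma> r) X x \<in> supported I"
  by (rule supported_mono[OF assms]; simp add: super_weight_sum_simps)+

lemma carrier_super_weight_sum: "carrier (super_weight_sum I \<sigma> r) = supported I"
proof
  show "carrier (super_weight_sum I \<sigma> r) \<subseteq> supported I"
    by (auto simp: carrier_def super_weight_sum_simps intro: supported_add)
  show "supported I \<subseteq> carrier (super_weight_sum I \<sigma> r)"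
  proof
    fix x :: "int \<times> nat \<Rightarrow> complex^2" assume x: "x \<in> supported I"
    let ?a = "\<lambda>i. vector [x i $ 1, 0] :: complex^2" and ?b = "\<lambda>i. vector [0, x i $ 2] :: complex^2"
    have "?a \<in> ev (super_weight_sum I \<sigma> r)" "?b \<in> od (super_weight_sum I \<sigma> r)"
      by (auto simp: super_weight_sum_simps vec_eq_iff forall_2 intro!: supported_mono[OF x])
    moreover have "x = ?a + ?b"
      by (auto simp: fun_eq_iff vec_eq_iff forall_2)
    ultimately show "x \<in> carrier (super_weight_sum I \<sigma> r)"
      unfolding carrier_def by blast
  qed
qed

section \<open>The odd operators and the parity of weight spaces\<close>

context su11_representation
begin

abbreviation U where "U \<equiv> rho R gen_U"
abbreviation S where "S \<equiv> rho R gen_S"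

lemma even_odd_zero:
  assumes "x \<in> ev R" "y \<in> od R" "x + y = 0"
  shows "x = 0" "y = 0"
proof -
  from assms(3) have "y = - x" by (simp add: add_eq_0_iff)
  then have "y \<in> ev R \<inter> od R"
    using assms vs.subspace_neg[OF subspace_even] by simp
  then show "y = 0" using even_Int_odd by blast
  with assms(3) show "x = 0" by simp
qed

lemma U_even: "v \<in> ev R \<Longrightarrow> U v \<in> od R" and U_odd: "v \<in> od R \<Longrightarrow> U v \<in> ev R"
  and S_even: "v \<in> ev R \<Longrightarrow> S v \<in> od R"
  using alg_odd_even alg_odd_odd generators by blast+

lemma odd_closed:
  assumes "X \<in> su11" "X \<in> su11_odd" "v \<in> V"
  shows "rho R X v \<in> V"
proof -
  from assms(3) obtain x y where xy: "x \<in> ev R" "y \<in> od R" "v = y + x"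
    by (auto simp: carrier_def add.commute)
  then have "rho R X v = rho R X y + rho R X x"
    using rho_add[OF assms(1)] ev_subset od_subset by blast
  then show ?thesis
    using alg_odd_even[OF assms(2)] alg_odd_odd[OF assms(2)] xy unfolding carrier_def by blast
qed

lemma U_closed: "v \<in> V \<Longrightarrow> U v \<in> V" and S_closed: "v \<in> V \<Longrightarrow> S v \<in> V"
  by (simp_all add: odd_closed generators)

lemma rho_expand:
  assumes "X \<in> su11" "v \<in> V"
  shows "rho R X v = of_real (Im (X $ 1 $ 1)) \<cdot> C v +
    (of_real (Re (X $ 1 $ 2)) \<cdot> U v + of_real (Im (X $ 1 $ 2)) \<cdot> S v)"
proof -
  let ?a = "Im (X $ 1 $ 1)" and ?b = "Re (X $ 1 $ 2)" and ?c = "Im (X $ 1 $ 2)"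
  have in_su11: "?a *\<^sub>R gen_C \<in> su11" "?b *\<^sub>R gen_U \<in> su11" "?c *\<^sub>R gen_S \<in> su11"
    "?b *\<^sub>R gen_U + ?c *\<^sub>R gen_S \<in> su11"
    using generators unfolding su11_def by (auto intro: span_add span_scale)
  have "rho R X v = rho R (?a *\<^sub>R gen_C + (?b *\<^sub>R gen_U + ?c *\<^sub>R gen_S)) v"
    using su11_expand[OF assms(1)] by simp
  also have "\<dots> = of_real ?a \<cdot> C v + (of_real ?b \<cdot> U v + of_real ?c \<cdot> S v)"
    using assms in_su11 generators by (simp only: alg_add alg_scaleR)
  finally show ?thesis .
qed

lemma rho_closed: "X \<in> su11 \<Longrightarrow> v \<in> V \<Longrightarrow> rho R X v \<in> V"
  by (simp add: rho_expand V_add V_scale C_closed U_closed S_closed)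

lemma rho_sum:
  "X \<in> su11 \<Longrightarrow> (\<And>i. i \<in> A \<Longrightarrow> f i \<in> V) \<Longrightarrow> rho R X (\<Sum>i\<in>A. f i) = (\<Sum>i\<in>A. rho R X (f i))"
  by (induction A rule: infinite_finite_induct) (auto simp: rho_zero rho_add V_sum)

lemma act_sum:
  "t \<in> S1 \<Longrightarrow> (\<And>i. i \<in> A \<Longrightarrow> f i \<in> V) \<Longrightarrow> act R t (\<Sum>i\<in>A. f i) = (\<Sum>i\<in>A. act R t (f i))"
proof (induction A rule: infinite_finite_induct)
  case (insert x F)
  then have "act R t (f x + sum f F) = act R t (f x) + act R t (sum f F)"
    by (intro act_add V_sum) auto
  with insert show ?case by simp
qed (auto simp: act_zero)

text \<open>The bracket of an odd element with itself is twice its square, so the structure constant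
  -2 becomes -1.\<close>

lemma odd_square:
  assumes "X \<in> su11" "X \<in> su11_odd" "anticommutator X X = (- 2) *\<^sub>R gen_C" "v \<in> V"
  shows "rho R X (rho R X v) = - C v"
proof -
  have "(- 2) \<cdot> C v = rho R X (rho R X v) + rho R X (rho R X v)"
    using alg_anticommutator[OF assms(2,2,4)] alg_scaleR[OF generators(1) assms(4), of "- 2"] assms(3)
    by simp
  also have "\<dots> = 2 \<cdot> rho R X (rho R X v)"
    using vs.scale_left_distrib[of 1 1] by simp
  finally have "(- 1) \<cdot> C v = rho R X (rho R X v)"
    using vs.scale_left_imp_eq[of 2 "(- 1) \<cdot> C v"] by simp
  then show ?thesis by simp
qed

lemma UU: "v \<in> V \<Longrightarrow> U (U v) = - C v" and SS: "v \<in> V \<Longrightarrow> S (S v) = - C v"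
  by (simp_all add: odd_square generators su11_brackets)

lemma SU: assumes "v \<in> V" shows "S (U v) = - U (S v)"
proof -
  have "rho R 0 v = 0"
    using alg_scaleR[OF generators(1) assms, of 0] by simp
  then have "U (S v) + S (U v) = 0"
    using alg_anticommutator[OF generators(5,6) assms] su11_brackets(3) by simp
  then show ?thesis by (simp add: add_eq_0_iff)
qed

lemma weight_V: "v \<in> weight_space R m \<Longrightarrow> v \<in> V"
  using weight_subset by blast

lemma weight_rho:
  assumes "X \<in> su11" "v \<in> weight_space R m"
  shows "rho R X v \<in> weight_space R m"
  unfolding weight_space_def
proof (intro CollectI conjI ballI)
  show "rho R X v \<in> V"
    using rho_closed assms weight_V by blast
  show "act R t (rho R X v) = (t powi m) \<cdot> rho R X v" if "t \<in> S1" for t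
  proof -
    have "act R t v = (t powi m) \<cdot> v"
      using that assms(2) by (auto simp: weight_space_def)
    with alg_grp[OF that assms(1) weight_V[OF assms(2)]] show ?thesis
      by (simp add: rho_scale[OF assms(1) weight_V[OF assms(2)]])
  qed
qed

text \<open>The circle preserves parity, so \<open>act R t - t powi m\<close> sends the two parts of
  \<open>v\<close> to an even and an odd vector with sum zero; both must vanish.\<close>

lemma weight_parts:
  assumes "v \<in> weight_space R m" "x \<in> ev R" "y \<in> od R" "v = x + y"
  shows "x \<in> weight_space R m" "y \<in> weight_space R m"
proof -
  have "act R t x - (t powi m) \<cdot> x = 0 \<and> act R t y - (t powi m) \<cdot> y = 0" if t: "t \<in> S1" for t
  proof -
    have "x \<in> V" "y \<in> V" using assms ev_subset od_subset by blast+
    then have "act R t x + act R t y = act R t v"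
      using act_add[OF t] assms(4) by simp
    also have "\<dots> = (t powi m) \<cdot> x + (t powi m) \<cdot> y"
      using t assms(1) vs.scale_right_distrib unfolding assms(4) weight_space_def by auto
    finally have "act R t x + act R t y = (t powi m) \<cdot> x + (t powi m) \<cdot> y" .
    then have "(act R t x - (t powi m) \<cdot> x) + (act R t y - (t powi m) \<cdot> y) = 0"
      by (simp add: algebra_simps)
    moreover have "act R t x - (t powi m) \<cdot> x \<in> ev R"
      using grp_even[OF t] assms
      by (intro vs.subspace_diff[OF subspace_even] vs.subspace_scale[OF subspace_even]) auto
    moreover have "act R t y - (t powi m) \<cdot> y \<in> od R"
      using grp_odd[OF t] assms
      by (intro vs.subspace_diff[OF subspace_odd] vs.subspace_scale[OF subspace_odd]) auto
    ultimately show ?thesis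
      using even_odd_zero by blast
  qed
  then show "x \<in> weight_space R m" "y \<in> weight_space R m"
    using assms ev_subset od_subset by (auto simp: weight_space_def)
qed

lemma carrier_weight_rep: "carrier (weight_rep R m) = weight_space R m"
proof
  show "carrier (weight_rep R m) \<subseteq> weight_space R m"
    using vs.subspace_add[OF subspace_weight_space] by (auto simp: carrier_def weight_rep_def)
  show "weight_space R m \<subseteq> carrier (weight_rep R m)"
  proof
    fix v assume v: "v \<in> weight_space R m"
    then obtain x y where xy: "x \<in> ev R" "y \<in> od R" "v = x + y"
      using weight_V by (fastforce simp: carrier_def)
    with weight_parts[OF v xy] show "v \<in> carrier (weight_rep R m)"
      by (auto simp: carrier_def weight_rep_def)
  qed
qed

text \<open>Applying \<open>C - \<i> a\<close> to the relation removes the term of weight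
  \<open>a\<close> and multiplies each other term by the nonzero scalar \<open>\<i> (k - a)\<close>.
  The induction hypothesis is used for these rescaled vectors.\<close>

lemma weights_independent:
  assumes "finite M" "\<And>m. m \<in> M \<Longrightarrow> w m \<in> weight_space R m" "(\<Sum>m\<in>M. w m) = 0" "m \<in> M"
  shows "w m = 0"
  using assms
proof (induction M arbitrary: w m rule: finite_induct)
  case (insert a M)
  have wt: "w k \<in> weight_space R k" if "k \<in> insert a M" for k
    using insert.prems(1) that by blast
  then have V: "w k \<in> V" if "k \<in> insert a M" for k
    using weight_V that by blast
  have s: "w a + (\<Sum>k\<in>M. w k) = 0"
    using insert by simp
  have "0 = C (w a + (\<Sum>k\<in>M. w k)) - (\<i> * of_int a) \<cdot> (w a + (\<Sum>k\<in>M. w k))"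
    unfolding s by (simp add: rho_zero generators)
  also have "C (w a + (\<Sum>k\<in>M. w k)) = (\<i> * of_int a) \<cdot> w a + (\<Sum>k\<in>M. (\<i> * of_int k) \<cdot> w k)"
    using V weight_C[OF wt] by (simp add: rho_add rho_sum generators V_sum)
  also have "\<dots> - (\<i> * of_int a) \<cdot> (w a + (\<Sum>k\<in>M. w k)) = (\<Sum>k\<in>M. (\<i> * of_int (k - a)) \<cdot> w k)"
    by (simp add: vs.scale_right_distrib vs.scale_sum_right sum_subtractf right_diff_distrib
        vs.scale_left_diff_distrib)
  finally have sum0: "(\<Sum>k\<in>M. (\<i> * of_int (k - a)) \<cdot> w k) = 0" by simp
  have M0: "w k = 0" if k: "k \<in> M" for k
  proof -
    have "(\<i> * of_int (k - a)) \<cdot> w k = 0"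
    proof (rule insert.IH[OF _ sum0 k])
      show "(\<i> * of_int (k - a)) \<cdot> w k \<in> weight_space R k" if "k \<in> M" for k
        using wt that by (intro vs.subspace_scale[OF subspace_weight_space]) auto
    qed
    moreover have "k \<noteq> a" using insert.hyps k by blast
    ultimately show ?thesis by simp
  qed
  with s have "w a = 0" by simp
  with M0 insert.prems(3) show ?case by blast
qed simp

section \<open>Eigenspaces of \<open>U S\<close> and the blocks they generate\<close>

text \<open>The possible images of the even basis vector of a super weight space: in the model
  \<open>S\<close> sends this vector to \<open>\<sigma> m / r\<close> times the odd one, and
  \<open>U\<close> returns with the factor \<open>r\<close>.\<close>

definition US_eigenspace where
  "US_eigenspace \<sigma> m = {x \<in> ev R \<inter> weight_space R m. U (S x) = (\<sigma> * of_int m) \<cdot> x}"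

lemma US_eigenspaceD:
  assumes "x \<in> US_eigenspace \<sigma> m"
  shows "x \<in> ev R" "x \<in> weight_space R m" "x \<in> V" "U (S x) = (\<sigma> * of_int m) \<cdot> x"
  using assms weight_V by (auto simp: US_eigenspace_def)

lemma subspace_US_eigenspace: "vs.subspace (US_eigenspace \<sigma> m)"
proof -
  have "ev R \<inter> weight_space R m \<subseteq> V"
    using ev_subset by blast
  moreover have sub: "vs.subspace (ev R \<inter> weight_space R m)"
    by (intro vs.subspace_inter subspace_even subspace_weight_space)
  ultimately show ?thesis
    unfolding US_eigenspace_def
    by (intro vs.subspaceI)
      (auto simp: rho_zero rho_add rho_scale generators S_closed subset_iff vs.scale_right_distrib
        vs.scale_left_commute V_add V_scale
        intro: vs.subspace_0 vs.subspace_add vs.subspace_scale subspace_even subspace_weight_space)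
qed

lemma US_eigenspace_direct:
  assumes "m \<noteq> 0" "u \<in> US_eigenspace 1 m" "v \<in> US_eigenspace (- 1) m" "u + v = 0"
  shows "u = 0" "v = 0"
proof -
  have "0 = U (S (u + v))"
    using assms(4) by (simp add: rho_zero generators)
  also have "\<dots> = of_int m \<cdot> (u - v)"
    using US_eigenspaceD[OF assms(2)] US_eigenspaceD[OF assms(3)]
    by (simp add: rho_add generators S_closed vs.scale_right_diff_distrib)
  finally have "u = v" using assms(1) by simp
  with assms(4) have "2 \<cdot> u = 0"
    using vs.scale_left_distrib[of 1 1 u] by simp
  then show "u = 0" by simp
  with \<open>u = v\<close> show "v = 0" by simp
qed

text \<open>As \<open>U S\<close> squares to the nonzero scalar \<open>m^2\<close>, the operators
  \<open>(1 + \<sigma> U S / m) / 2\<close> for \<open>\<sigma> = 1\<close> and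
  \<open>\<sigma> = - 1\<close> are the projections onto the two eigenspaces and add up to the
  identity.\<close>

lemma US_eigenspace_decompose:
  assumes "m \<noteq> 0" "w \<in> ev R" "w \<in> weight_space R m"
  obtains u v where "u \<in> US_eigenspace 1 m" "v \<in> US_eigenspace (- 1) m" "w = u + v"
proof -
  let ?d = "U (S w)"
  define c where "c = inverse (of_int m :: complex)"
  have wV: "w \<in> V" using assms ev_subset by blast
  have d: "?d \<in> ev R" "?d \<in> weight_space R m" "?d \<in> V"
    using assms U_odd S_even weight_rho generators wV U_closed S_closed by auto
  \<comment> \<open>Anticommutation turns \<open>U S U S\<close> into \<open>- U U S S\<close>,
    which is \<open>- C C\<close> because both squares are \<open>- C\<close>; on weight
    \<open>m\<close> this is \<open>m^2\<close>.\<close>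
  have "U (S ?d) = - U (U (S (S w)))"
    using SU[OF S_closed[OF wV]] rho_scale[OF generators(2), of "U (S (S w))" "- 1"] wV
    by (simp add: U_closed S_closed)
  also have "\<dots> = C (S (S w))"
    using wV by (simp add: UU S_closed)
  also have "\<dots> = - C (C w)"
    using rho_scale[OF generators(1), of "C w" "- 1"] wV by (simp add: SS C_closed)
  also have "\<dots> = (of_int m * of_int m) \<cdot> w"
    using weight_C[OF assms(3)] rho_scale[OF generators(1) wV] by (simp add: mult.commute mult.left_commute)
  finally have dd: "U (S ?d) = (of_int m * of_int m) \<cdot> w" .
  have "(1/2) \<cdot> (w + (\<sigma> * c) \<cdot> ?d) \<in> US_eigenspace \<sigma> m" if "\<sigma> * \<sigma> = 1" for \<sigma>
  proof -
    have "(1/2) \<cdot> (w + (\<sigma> * c) \<cdot> ?d) \<in> ev R \<inter> weight_space R m"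
      using assms d
      by (auto intro!: vs.subspace_add vs.subspace_scale subspace_even subspace_weight_space)
    moreover have "U (S ((1/2) \<cdot> (w + (\<sigma> * c) \<cdot> ?d))) = (1/2) \<cdot> (?d + (\<sigma> * c) \<cdot> U (S ?d))"
      using wV d by (simp add: rho_add rho_scale generators S_closed U_closed V_add V_scale)
    moreover have "(\<sigma> * of_int m) \<cdot> (1/2) \<cdot> (w + (\<sigma> * c) \<cdot> ?d) =
        (1/2) \<cdot> ((\<sigma> * of_int m) \<cdot> w + (\<sigma> * \<sigma> * (of_int m * c)) \<cdot> ?d)"
      by (simp add: vs.scale_right_distrib mult_ac)
    moreover have "(\<sigma> * c) \<cdot> U (S ?d) = (\<sigma> * (of_int m * c) * of_int m) \<cdot> w"
      unfolding dd by (simp add: mult_ac)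
    moreover have "of_int m * c = 1"
      using assms(1) by (simp add: c_def)
    ultimately show ?thesis
      using that by (simp add: US_eigenspace_def add.commute)
  qed
  from this[of 1] this[of "- 1"]
  have "(1/2) \<cdot> (w + c \<cdot> ?d) \<in> US_eigenspace 1 m" "(1/2) \<cdot> (w - c \<cdot> ?d) \<in> US_eigenspace (- 1) m"
    by simp_all
  moreover have "w = (1/2) \<cdot> (w + c \<cdot> ?d) + (1/2) \<cdot> (w - c \<cdot> ?d)"
    using vs.scale_left_distrib[of "1/2" "1/2" w]
    by (simp add: vs.scale_right_distrib vs.scale_right_diff_distrib)
  ultimately show thesis by (rule that)
qed

text \<open>\<open>block \<rho> x\<close> embeds the super weight space with square root \<open>\<rho>\<close> by sending its even basis
  vector to \<open>x\<close> and its odd basis vector to \<open>U x / \<rho>\<close>.\<close>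

definition block :: "complex \<Rightarrow> 'v \<Rightarrow> complex^2 \<Rightarrow> 'v" where
  "block \<rho> x z = (z $ 1) \<cdot> x + (z $ 2 / \<rho>) \<cdot> U x"

lemma block_V: "x \<in> V \<Longrightarrow> block \<rho> x z \<in> V"
  by (simp add: block_def V_add V_scale U_closed)

lemma block_zero [simp]: "block \<rho> x 0 = 0"
  by (simp add: block_def)

lemma block_add: "block \<rho> x (y + z) = block \<rho> x y + block \<rho> x z"
  by (simp add: block_def vs.scale_left_distrib add_divide_distrib algebra_simps)

lemma block_scale: "block \<rho> x (c *s z) = c \<cdot> block \<rho> x z"
  by (simp add: block_def vs.scale_right_distrib)

lemma block_weight: "x \<in> weight_space R m \<Longrightarrow> block \<rho> x z \<in> weight_space R m"
  unfolding block_def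
  by (intro vs.subspace_add vs.subspace_scale subspace_weight_space weight_rho generators)

lemma block_act: "x \<in> weight_space R m \<Longrightarrow> t \<in> S1 \<Longrightarrow> act R t (block \<rho> x z) = block \<rho> x ((t powi m) *s z)"
  using block_weight[of x m \<rho> z] by (simp add: weight_space_def block_scale)

text \<open>Everything follows from the action of the generators on \<open>x\<close> and
  \<open>U x\<close>. The only value not immediate is \<open>S x\<close>, which has to be shown
  proportional to \<open>U x\<close>.\<close>

lemma block_rho:
  assumes x: "x \<in> US_eigenspace \<sigma> m" and "m \<noteq> 0" "\<rho>\<^sup>2 = - \<i> * of_int m" "X \<in> su11"
  shows "rho R X (block \<rho> x z) = block \<rho> x (super_weight_matrix \<sigma> \<rho> m X *v z)"
proof -
  define k where "k = inverse \<rho>"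
  have "\<rho> \<noteq> 0" using assms by auto
  then have k: "\<rho> * k = 1" by (simp add: k_def)
  note xD = US_eigenspaceD[OF x]
  let ?y = "U x"
  have V: "x \<in> V" "?y \<in> V" using xD U_closed by auto
  have C: "C x = (\<i> * of_int m) \<cdot> x" "C ?y = (\<i> * of_int m) \<cdot> ?y"
    using weight_C weight_rho[OF generators(2)] xD by blast+
  have Uy: "U ?y = (\<rho> * \<rho>) \<cdot> x"
    using UU[OF V(1)] C(1) assms(3) by (simp add: power2_eq_square)
  have Sy: "S ?y = (- \<sigma> * of_int m) \<cdot> x"
    using SU[OF V(1)] xD(4) by simp
  \<comment> \<open>Two evaluations of \<open>U U S x\<close>: applying \<open>U\<close> to the
    eigenvalue equation gives \<open>\<sigma> m U x\<close>, while \<open>U U\<close> is the scalar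
    \<open>\<rho>^2\<close>. Dividing yields \<open>S x\<close>.\<close>
  have "U (U (S x)) = (\<sigma> * of_int m) \<cdot> ?y"
    using xD(4) rho_scale[OF generators(2) V(1)] by simp
  moreover have "U (U (S x)) = (\<rho> * \<rho>) \<cdot> S x"
    using UU[OF S_closed[OF V(1)]] weight_C[OF weight_rho[OF generators(3) xD(2)]] assms(3)
    by (simp add: power2_eq_square)
  ultimately have "(k * k) \<cdot> (\<rho> * \<rho>) \<cdot> S x = (k * k) \<cdot> (\<sigma> * of_int m) \<cdot> ?y"
    by simp
  moreover have "k * k * (\<rho> * \<rho>) = (\<rho> * k) * (\<rho> * k)"
    by (simp add: mult_ac)
  ultimately have Sx: "S x = (k * k * (\<sigma> * of_int m)) \<cdot> ?y"
    by (simp add: k)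
  define a b c where abc: "a = complex_of_real (Im (X $ 1 $ 1))"
    "b = complex_of_real (Re (X $ 1 $ 2))" "c = complex_of_real (Im (X $ 1 $ 2))"
  define p q where pq: "p = z $ 1" "q = z $ 2"
  have block: "block \<rho> x z = p \<cdot> x + (q * k) \<cdot> ?y"
    by (simp add: block_def pq k_def divide_inverse)
  have "rho R X (block \<rho> x z) = a \<cdot> (\<i> * of_int m) \<cdot> (p \<cdot> x + (q * k) \<cdot> ?y) +
     (b \<cdot> (p \<cdot> ?y + (q * k) \<cdot> (\<rho> * \<rho>) \<cdot> x) +
      c \<cdot> (p \<cdot> (k * k * (\<sigma> * of_int m)) \<cdot> ?y + (q * k) \<cdot> (- \<sigma> * of_int m) \<cdot> x))"
    unfolding rho_expand[OF assms(4) block_V[OF V(1)]] unfolding abc[symmetric] block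
    using V by (simp add: rho_add rho_scale generators V_scale C Uy Sx Sy vs.scale_right_distrib mult_ac)
  also have "\<dots> = (a * \<i> * of_int m * p + b * q * (\<rho> * k) * \<rho> - c * q * k * \<sigma> * of_int m) \<cdot> x +
      (a * \<i> * of_int m * q * k + b * p + c * p * k * k * \<sigma> * of_int m) \<cdot> ?y"
    by (simp add: vs.scale_right_distrib vs.scale_left_distrib vs.scale_left_diff_distrib
        algebra_simps)
  also have "a * \<i> * of_int m * p + b * q * (\<rho> * k) * \<rho> - c * q * k * \<sigma> * of_int m =
      (super_weight_matrix \<sigma> \<rho> m X *v z) $ 1"
    unfolding k
    by (simp add: matrix_vector_mult_def sum_2 super_weight_matrix_def mat2_def abc pq k_def
        divide_inverse scaleR_conv_of_real[where 'a = complex] algebra_simps)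
  \<comment> \<open>Writing 1 as \<open>\<rho> * k\<close> in the term with \<open>b\<close> lets
    \<open>k\<close> be factored out; it is the normalisation of the odd basis vector
    \<open>U x / \<rho>\<close>.\<close>
  also have "a * \<i> * of_int m * q * k + b * p + c * p * k * k * \<sigma> * of_int m =
      (a * \<i> * of_int m * q + b * \<rho> * p + c * p * k * \<sigma> * of_int m) * k"
    using k by (simp add: distrib_right mult.assoc mult.left_commute[of \<rho>])
  also have "a * \<i> * of_int m * q + b * \<rho> * p + c * p * k * \<sigma> * of_int m =
      (super_weight_matrix \<sigma> \<rho> m X *v z) $ 2"
    by (simp add: matrix_vector_mult_def sum_2 super_weight_matrix_def mat2_def abc pq k_def
        divide_inverse scaleR_conv_of_real[where 'a = complex] algebra_simps)
  finally show ?thesis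
    by (simp add: block_def k_def divide_inverse)
qed

text \<open>An ordered basis of the eigenspace; its length \<open>n\<close> is the multiplicity of
  the corresponding super weight space.\<close>

definition frame :: "complex \<Rightarrow> int \<Rightarrow> nat \<Rightarrow> (nat \<Rightarrow> 'v) \<Rightarrow> bool" where
  "frame \<sigma> m n e \<longleftrightarrow> (\<forall>j<n. e j \<in> US_eigenspace \<sigma> m) \<and>
     (\<forall>a. (\<Sum>j<n. a j \<cdot> e j) = 0 \<longrightarrow> (\<forall>j<n. a j = 0)) \<and>
     (\<forall>v\<in>US_eigenspace \<sigma> m. \<exists>a. v = (\<Sum>j<n. a j \<cdot> e j))"

lemma frame_exists:
  assumes "finite_dimensional R (weight_space R m)"
  shows "\<exists>n e. frame \<sigma> m n e"
proof -
  from assms obtain B where B: "finite B" "weight_space R m = vs.span B"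
    by (auto simp: finite_dimensional_def)
  then have sub: "US_eigenspace \<sigma> m \<subseteq> vs.span B"
    by (auto simp: US_eigenspace_def)
  show ?thesis
  proof (rule vs.subspace_basis_family[OF B(1) subspace_US_eigenspace sub])
    fix n and e :: "nat \<Rightarrow> 'v"
    assume "\<And>j. j < n \<Longrightarrow> e j \<in> US_eigenspace \<sigma> m"
      "\<And>a. (\<Sum>j<n. a j \<cdot> e j) = 0 \<Longrightarrow> \<forall>j<n. a j = 0"
      "\<And>v. v \<in> US_eigenspace \<sigma> m \<Longrightarrow> \<exists>a. v = (\<Sum>j<n. a j \<cdot> e j)"
    then have "frame \<sigma> m n e"
      unfolding frame_def by blast
    then show "\<exists>n e. frame \<sigma> m n e" by blast
  qed
qed

lemma frame_comb: "frame \<sigma> m n e \<Longrightarrow> (\<Sum>j<n. a j \<cdot> e j) \<in> US_eigenspace \<sigma> m"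
  by (auto simp: frame_def intro!: vs.subspace_sum vs.subspace_scale subspace_US_eigenspace)

lemma frame_independent: "frame \<sigma> m n e \<Longrightarrow> (\<Sum>j<n. a j \<cdot> e j) = 0 \<Longrightarrow> j < n \<Longrightarrow> a j = 0"
  by (simp add: frame_def)

text \<open>Gathers all odd coordinates under a single \<open>U\<close>, so that questions about
  blocks become questions about two even vectors in the eigenspace.\<close>

lemma sum_block:
  assumes "frame \<sigma> m n e"
  shows "(\<Sum>j<n. block \<rho> (e j) (x j)) =
    (\<Sum>j<n. (x j $ 1) \<cdot> e j) + inverse \<rho> \<cdot> U (\<Sum>j<n. (x j $ 2) \<cdot> e j)"
proof -
  have V: "e j \<in> V" if "j < n" for j
    using assms that US_eigenspaceD(3) by (auto simp: frame_def)
  then have "U (\<Sum>j<n. (x j $ 2) \<cdot> e j) = (\<Sum>j<n. (x j $ 2) \<cdot> U (e j))"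
    by (subst rho_sum) (auto simp: generators V_scale rho_scale)
  then show ?thesis
    by (simp add: block_def sum.distrib vs.scale_sum_right divide_inverse mult.commute)
qed

text \<open>Parity separates the two coordinates, \<open>U\<close> can be cancelled on a nonzero
  weight, the eigenvalues \<open>m\<close> and \<open>- m\<close> separate the two signs, and the
  frames do the rest.\<close>

lemma blocks_independent:
  assumes m: "m \<noteq> 0" and \<rho>: "\<rho> \<noteq> 0"
    and e: "frame 1 m n e" and f: "frame (- 1) m l f"
    and eq: "(\<Sum>j<n. block \<rho> (e j) (x j)) + (\<Sum>j<l. block \<rho> (f j) (y j)) = 0"
  shows "\<forall>j<n. x j = 0" "\<forall>j<l. y j = 0"
proof -
  \<comment> \<open>Indexed by the coordinate of the model: 1 collects the even and 2 the odd
    coefficients.\<close>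
  define A where "A = (\<lambda>k::2. \<Sum>j<n. (x j $ k) \<cdot> e j)"
  define B where "B = (\<lambda>k::2. \<Sum>j<l. (y j $ k) \<cdot> f j)"
  have A: "A k \<in> US_eigenspace 1 m" and B: "B k \<in> US_eigenspace (- 1) m" for k
    by (simp_all add: A_def B_def frame_comb[OF e] frame_comb[OF f])
  have AV: "A k \<in> V" and BV: "B k \<in> V" for k
    using US_eigenspaceD A B by blast+
  have ev: "A k + B k \<in> ev R" for k
    using US_eigenspaceD A B by (intro vs.subspace_add[OF subspace_even]) blast+
  have "(A 1 + inverse \<rho> \<cdot> U (A 2)) + (B 1 + inverse \<rho> \<cdot> U (B 2)) = 0"
    using eq unfolding sum_block[OF e] sum_block[OF f] A_def B_def .
  then have "(A 1 + B 1) + inverse \<rho> \<cdot> U (A 2 + B 2) = 0"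
    by (simp add: rho_add[OF generators(2) AV BV] vs.scale_right_distrib algebra_simps)
  moreover have "inverse \<rho> \<cdot> U (A 2 + B 2) \<in> od R"
    using U_even[OF ev] vs.subspace_scale[OF subspace_odd] by blast
  ultimately have 1: "A 1 + B 1 = 0" and "inverse \<rho> \<cdot> U (A 2 + B 2) = 0"
    using even_odd_zero ev by blast+
  with \<rho> have "U (A 2 + B 2) = 0" by simp
  then have "C (A 2 + B 2) = 0"
    using UU[OF V_add[OF AV[of 2] BV[of 2]]] by (simp add: rho_zero generators)
  moreover have "A 2 + B 2 \<in> weight_space R m"
    using US_eigenspaceD A B by (intro vs.subspace_add[OF subspace_weight_space]) blast+
  ultimately have 2: "A 2 + B 2 = 0"
    using weight_C m by force
  have zero: "A k = 0 \<and> B k = 0" for k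
    using exhaust_2[of k] 1 2 US_eigenspace_direct[OF m A B] by blast
  have "x j $ k = 0" if "j < n" for j k
    using frame_independent[OF e, of "\<lambda>j. x j $ k"] zero[of k] that by (simp add: A_def)
  then show "\<forall>j<n. x j = 0" by (simp add: vec_eq_iff)
  have "y j $ k = 0" if "j < l" for j k
    using frame_independent[OF f, of "\<lambda>j. y j $ k"] zero[of k] that by (simp add: B_def)
  then show "\<forall>j<l. y j = 0" by (simp add: vec_eq_iff)
qed

text \<open>The even part decomposes directly into eigenvectors. The odd part is first written as
  \<open>U w / \<rho>\<close> with \<open>w\<close> even, and then \<open>w\<close> is
  decomposed.\<close>

lemma blocks_span:
  assumes m: "m \<noteq> 0" and \<rho>: "\<rho> \<noteq> 0"
    and e: "frame 1 m n e" and f: "frame (- 1) m l f" and v: "v \<in> weight_space R m"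
  obtains x y where "v = (\<Sum>j<n. block \<rho> (e j) (x j)) + (\<Sum>j<l. block \<rho> (f j) (y j))"
proof -
  have dec: "\<exists>a b. w = (\<Sum>j<n. a j \<cdot> e j) + (\<Sum>j<l. b j \<cdot> f j)"
    if "w \<in> ev R" "w \<in> weight_space R m" for w
    using US_eigenspace_decompose[OF m that] e f unfolding frame_def by metis
  from v obtain s t where st: "s \<in> ev R" "t \<in> od R" "v = s + t"
    using weight_V by (fastforce simp: carrier_def)
  note wt = weight_parts[OF v st]
  have tV: "t \<in> V" using st od_subset by blast
  define c where "c = - \<i> * complex_of_int m"
  have c: "c \<noteq> 0" using m by (simp add: c_def)
  have UUt: "U (U t) = c \<cdot> t"
    using UU[OF tV] weight_C[OF wt(2)] by (simp add: c_def)
  \<comment> \<open>The preimage is explicit because \<open>U U\<close> multiplies \<open>t\<close>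
    by the nonzero scalar \<open>c\<close>; the factor \<open>\<rho>\<close> cancels the one built
    into \<open>block\<close>.\<close>
  define w where "w = (\<rho> / c) \<cdot> U t"
  have w: "w \<in> ev R" "w \<in> weight_space R m"
    unfolding w_def using U_odd[OF st(2)] weight_rho[OF generators(2) wt(2)]
    by (auto intro: vs.subspace_scale subspace_even subspace_weight_space)
  have t: "t = inverse \<rho> \<cdot> U w"
    using c \<rho> unfolding w_def rho_scale[OF generators(2) U_closed[OF tV]] UUt
    by simp
  obtain a b where s_eq: "s = (\<Sum>j<n. a j \<cdot> e j) + (\<Sum>j<l. b j \<cdot> f j)"
    using dec st(1) wt(1) by blast
  obtain a' b' where w_eq: "w = (\<Sum>j<n. a' j \<cdot> e j) + (\<Sum>j<l. b' j \<cdot> f j)"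
    using dec w by blast
  have "U w = U (\<Sum>j<n. a' j \<cdot> e j) + U (\<Sum>j<l. b' j \<cdot> f j)"
    unfolding w_eq using US_eigenspaceD(3) frame_comb[OF e] frame_comb[OF f] by (intro rho_add generators) blast+
  then have "v = (\<Sum>j<n. block \<rho> (e j) (vector [a j, a' j])) +
      (\<Sum>j<l. block \<rho> (f j) (vector [b j, b' j]))"
    unfolding sum_block[OF e] sum_block[OF f] st(3) t
    by (simp add: s_eq vs.scale_right_distrib algebra_simps)
  then show thesis by (rule that)
qed

section \<open>The intertwiner from finitely supported families to \<open>V\<close>\<close>

definition glue :: "(int \<Rightarrow> complex) \<Rightarrow> (int \<times> nat \<Rightarrow> 'v) \<Rightarrow> (int \<times> nat \<Rightarrow> complex^2) \<Rightarrow> 'v" where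
  "glue r e x = (\<Sum>i | x i \<noteq> 0. block (r (fst i)) (e i) (x i))"

text \<open>Supports change under addition and under the actions; extra indices contribute zero
  blocks, so families can be compared over a common finite set.\<close>

lemma glue_superset:
  assumes "finite F" "{i. x i \<noteq> 0} \<subseteq> F"
  shows "glue r e x = (\<Sum>i\<in>F. block (r (fst i)) (e i) (x i))"
  unfolding glue_def by (rule sum.mono_neutral_left) (use assms in auto)

lemma glue_add:
  assumes "x \<in> supported I" "y \<in> supported I"
  shows "glue r e (x + y) = glue r e x + glue r e y"
proof -
  let ?F = "{i. x i \<noteq> 0} \<union> {i. y i \<noteq> 0}"
  have "finite ?F" using assms by (simp add: supported_def)
  then show ?thesis
    by (subst (1 2 3) glue_superset[of ?F]) (auto simp: block_add sum.distrib)
qed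

definition glueable where
  "glueable \<sigma> r I e \<longleftrightarrow> (\<forall>i\<in>I. e i \<in> US_eigenspace \<sigma> (fst i) \<and> fst i \<noteq> 0 \<and> (r (fst i))\<^sup>2 = - \<i> * of_int (fst i))"

lemma
  assumes g: "glueable \<sigma> r I e" and x: "x \<in> supported I"
  shows glue_V: "glue r e x \<in> V"
    and glue_scale: "glue r e (scl (super_weight_sum I \<sigma> r) c x) = c \<cdot> glue r e x"
    and glue_act: "t \<in> S1 \<Longrightarrow> glue r e (act (super_weight_sum I \<sigma> r) t x) = act R t (glue r e x)"
    and glue_rho: "X \<in> su11 \<Longrightarrow> glue r e (rho (super_weight_sum I \<sigma> r) X x) = rho R X (glue r e x)"
    and glue_even: "x \<in> ev (super_weight_sum I \<sigma> r) \<Longrightarrow> glue r e x \<in> ev R"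
    and glue_odd: "x \<in> od (super_weight_sum I \<sigma> r) \<Longrightarrow> glue r e x \<in> od R"
proof -
  let ?F = "{i. x i \<noteq> 0}"
  have F: "finite ?F" "?F \<subseteq> I" using x by (auto simp: supported_def)
  have e: "e i \<in> US_eigenspace \<sigma> (fst i)" "fst i \<noteq> 0" "(r (fst i))\<^sup>2 = - \<i> * of_int (fst i)" if "i \<in> ?F" for i
    using g F(2) that unfolding glueable_def by blast+
  have V: "block (r (fst i)) (e i) (x i) \<in> V" if "i \<in> ?F" for i
    using block_V[OF US_eigenspaceD(3)[OF e(1)]] that by blast
  show "glue r e x \<in> V"
    unfolding glue_def by (rule V_sum) (use V in blast)
  show "glue r e (scl (super_weight_sum I \<sigma> r) c x) = c \<cdot> glue r e x"
    by (subst glue_superset[OF F(1)])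
      (auto simp: super_weight_sum_simps block_scale glue_def vs.scale_sum_right)
  show "glue r e (act (super_weight_sum I \<sigma> r) t x) = act R t (glue r e x)" if t: "t \<in> S1"
  proof -
    have "glue r e (act (super_weight_sum I \<sigma> r) t x) =
        (\<Sum>i\<in>?F. block (r (fst i)) (e i) (act (super_weight_sum I \<sigma> r) t x i))"
      by (rule glue_superset[OF F(1)]) (auto simp: super_weight_sum_simps)
    also have "\<dots> = (\<Sum>i\<in>?F. act R t (block (r (fst i)) (e i) (x i)))"
    proof (rule sum.cong[OF refl])
      fix i assume i: "i \<in> ?F"
      with F(2) have "i \<in> I" by blast
      then show "block (r (fst i)) (e i) (act (super_weight_sum I \<sigma> r) t x i) =
          act R t (block (r (fst i)) (e i) (x i))"
        using block_act[OF US_eigenspaceD(2)[OF e(1)[OF i]] t] by (simp add: super_weight_sum_simps)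
    qed
    also have "\<dots> = act R t (glue r e x)"
      unfolding glue_def by (rule act_sum[OF t V, symmetric])
    finally show ?thesis .
  qed
  show "glue r e (rho (super_weight_sum I \<sigma> r) X x) = rho R X (glue r e x)" if X: "X \<in> su11"
  proof -
    have "glue r e (rho (super_weight_sum I \<sigma> r) X x) =
        (\<Sum>i\<in>?F. block (r (fst i)) (e i) (rho (super_weight_sum I \<sigma> r) X x i))"
      by (rule glue_superset[OF F(1)]) (auto simp: super_weight_sum_simps)
    also have "\<dots> = (\<Sum>i\<in>?F. rho R X (block (r (fst i)) (e i) (x i)))"
    proof (rule sum.cong[OF refl])
      fix i assume i: "i \<in> ?F"
      with F(2) have "i \<in> I" by blast
      then show "block (r (fst i)) (e i) (rho (super_weight_sum I \<sigma> r) X x i) =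
          rho R X (block (r (fst i)) (e i) (x i))"
        using block_rho[OF e[OF i] X] by (simp add: super_weight_sum_simps)
    qed
    also have "\<dots> = rho R X (glue r e x)"
      unfolding glue_def by (rule rho_sum[OF X V, symmetric])
    finally show ?thesis .
  qed
  show "glue r e x \<in> ev R" if "x \<in> ev (super_weight_sum I \<sigma> r)"
    unfolding glue_def
  proof (rule vs.subspace_sum[OF subspace_even])
    have x0: "x i $ 2 = 0" for i
      using that unfolding super_weight_sum_simps by blast
    fix i assume "i \<in> ?F"
    from US_eigenspaceD(1)[OF e(1)[OF this]] show "block (r (fst i)) (e i) (x i) \<in> ev R"
      using vs.subspace_scale[OF subspace_even] x0[of i] by (simp add: block_def)
  qed
  show "glue r e x \<in> od R" if "x \<in> od (super_weight_sum I \<sigma> r)"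
    unfolding glue_def
  proof (rule vs.subspace_sum[OF subspace_odd])
    have x0: "x i $ 1 = 0" for i
      using that unfolding super_weight_sum_simps by blast
    fix i assume "i \<in> ?F"
    from U_even[OF US_eigenspaceD(1)[OF e(1)[OF this]]] show "block (r (fst i)) (e i) (x i) \<in> od R"
      using vs.subspace_scale[OF subspace_odd] x0[of i] by (simp add: block_def)
  qed
qed

text \<open>Groups the blocks by weight and lets the inner sum run over the whole frame, the form
  needed for independence of weights and then of blocks.\<close>

lemma glue_by_weight:
  assumes "x \<in> supported (multiplicity_index p)" "finite M" "\<And>m j. x (m, j) \<noteq> 0 \<Longrightarrow> m \<in> M"
  shows "glue r e x = (\<Sum>m\<in>M. \<Sum>j<p m. block (r m) (e (m, j)) (x (m, j)))"
proof -
  have "{i. x i \<noteq> 0} \<subseteq> Sigma M (\<lambda>m. {..<p m})"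
    using assms(1,3) by (fastforce simp: supported_def multiplicity_index_def)
  then have "glue r e x = (\<Sum>i\<in>Sigma M (\<lambda>m. {..<p m}). block (r (fst i)) (e i) (x i))"
    using assms(2) by (intro glue_superset) auto
  also have "\<dots> = (\<Sum>m\<in>M. \<Sum>j<p m. block (r m) (e (m, j)) (x (m, j)))"
    using assms(2) by (subst sum.Sigma) (auto intro: sum.cong)
  finally show ?thesis .
qed

section \<open>Assembling the isomorphism\<close>

text \<open>Closure of the model carrier under all operations allows the inverse to be evaluated on
  each intertwining identity. Preservation of parity is the one property that needs an argument for
  the inverse, via the even and odd parts of the preimage.\<close>

lemma inverse_isomorphism:
  fixes D :: "('w::ab_group_add) su11_data"
  assumes bij: "bij_betw g (carrier D) V"
    and add: "\<And>x y. x \<in> carrier D \<Longrightarrow> y \<in> carrier D \<Longrightarrow> x + y \<in> carrier D \<and> g (x + y) = g x + g y"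
    and scale: "\<And>c x. x \<in> carrier D \<Longrightarrow> scl D c x \<in> carrier D \<and> g (scl D c x) = c \<cdot> g x"
    and zero: "0 \<in> carrier D"
    and even: "\<And>x. x \<in> ev D \<Longrightarrow> x \<in> carrier D \<and> g x \<in> ev R"
    and odd: "\<And>x. x \<in> od D \<Longrightarrow> x \<in> carrier D \<and> g x \<in> od R"
    and act: "\<And>t x. t \<in> S1 \<Longrightarrow> x \<in> carrier D \<Longrightarrow> act D t x \<in> carrier D \<and> g (act D t x) = act R t (g x)"
    and rho: "\<And>X x. X \<in> su11 \<Longrightarrow> x \<in> carrier D \<Longrightarrow> rho D X x \<in> carrier D \<and> g (rho D X x) = rho R X (g x)"
  shows "isomorphic R D"
proof -
  define f where "f = inv_into (carrier D) g"
  have f: "f v \<in> carrier D" "g (f v) = v" if "v \<in> V" for v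
    using bij that by (auto simp: f_def bij_betw_def inv_into_into f_inv_into_f)
  have fI: "f v = x" if "x \<in> carrier D" "g x = v" for v x
    using bij that by (auto simp: f_def bij_betw_def inv_into_f_f)
  have g0: "g 0 = 0"
    using add[OF zero zero] by simp
  have parts: "\<exists>a b. a \<in> ev D \<and> b \<in> od D \<and> f v = a + b \<and> v = g a + g b" if v: "v \<in> V" for v
  proof -
    obtain a b where ab: "a \<in> ev D" "b \<in> od D" "f v = a + b"
      using f(1)[OF v] by (auto simp: carrier_def)
    with f(2)[OF v] add[of a b] even odd show ?thesis by metis
  qed
  have "f v \<in> ev D" if v: "v \<in> ev R" for v
  proof -
    obtain a b where ab: "a \<in> ev D" "b \<in> od D" "f v = a + b" "v = g a + g b"
      using parts v ev_subset by blast
    \<comment> \<open>For even \<open>v\<close> this is a vanishing sum of an even and an odd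
      vector, so \<open>g b = 0\<close>; injectivity removes the odd part \<open>b\<close> of the
      preimage.\<close>
    then have "(g a - v) + g b = 0" by simp
    moreover have "g a - v \<in> ev R"
      using even ab v by (intro vs.subspace_diff[OF subspace_even]) blast+
    ultimately have "g b = 0"
      using even_odd_zero odd ab by blast
    then have "b = 0"
      using fI[of b 0] fI[OF zero g0] odd ab(2) by metis
    with ab show ?thesis by simp
  qed
  moreover have "f v \<in> od D" if v: "v \<in> od R" for v
  proof -
    obtain a b where ab: "a \<in> ev D" "b \<in> od D" "f v = a + b" "v = g a + g b"
      using parts v od_subset by blast
    then have "g a + (g b - v) = 0" by simp
    moreover have "g b - v \<in> od R"
      using odd ab v by (intro vs.subspace_diff[OF subspace_odd]) blast+
    ultimately have "g a = 0"
      using even_odd_zero even ab by blast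
    then have "a = 0"
      using fI[of a 0] fI[OF zero g0] even ab(1) by metis
    with ab show ?thesis by simp
  qed
  moreover have "bij_betw f V (carrier D)"
    unfolding f_def by (rule bij_betw_inv_into[OF bij])
  moreover have "linear_map_on (scl R) (scl D) V f"
    unfolding linear_map_on_def
  proof (intro conjI ballI allI)
    show "f (v + w) = f v + f w" if "v \<in> V" "w \<in> V" for v w
      using add[of "f v" "f w"] f that by (intro fI) auto
    show "f (c \<cdot> v) = scl D c (f v)" if "v \<in> V" for c v
      using scale[of "f v" c] f that by (intro fI) auto
  qed
  moreover have "f (act R t v) = act D t (f v)" if "t \<in> S1" "v \<in> V" for t v
    using act[OF that(1), of "f v"] f that(2) by (intro fI) auto
  moreover have "f (rho R X v) = rho D X (f v)" if "X \<in> su11" "v \<in> V" for X v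
    using rho[OF that(1), of "f v"] f that(2) by (intro fI) auto
  ultimately have "is_isomorphism R D f"
    unfolding is_isomorphism_def by blast
  then show ?thesis
    unfolding isomorphic_def by blast
qed

text \<open>The kernel is trivial by independence across weights and then within one weight. The
  image is a subspace containing every weight space, and these span \<open>V\<close>.\<close>

lemma isomorphic_decomposition:
  fixes r :: "int \<Rightarrow> complex"
  assumes r: "\<And>m. m \<noteq> 0 \<Longrightarrow> (r m)\<^sup>2 = - \<i> * of_int m"
    and fe: "\<And>m. frame 1 m (p m) (\<lambda>j. e (m, j))"
    and ff: "\<And>m. frame (- 1) m (q m) (\<lambda>j. f (m, j))"
  shows "isomorphic R (direct_sum2 (weight_rep R 0)
    (direct_sum2 (super_weight_sum (multiplicity_index p) 1 r)
      (super_weight_sum (multiplicity_index q) (- 1) r)))"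
    (is "isomorphic R (direct_sum2 ?W0 (direct_sum2 ?P ?Q))")
proof -
  let ?D = "direct_sum2 ?W0 (direct_sum2 ?P ?Q)"
  let ?I = "multiplicity_index p" and ?J = "multiplicity_index q"
  let ?g = "\<lambda>(v, x, y). v + (glue r e x + glue r f y)"
  have gp: "glueable 1 r ?I e" and gq: "glueable (- 1) r ?J f"
    using fe ff r by (auto simp: glueable_def multiplicity_index_def frame_def)
  have carrier: "carrier ?D = weight_space R 0 \<times> supported ?I \<times> supported ?J"
    by (simp add: carrier_direct_sum2 carrier_weight_rep carrier_super_weight_sum)
  have r0: "r m \<noteq> 0" if "m \<noteq> 0" for m
    using r[OF that] that by auto
  note W0_add = vs.subspace_add[OF subspace_weight_space]
    and W0_scale = vs.subspace_scale[OF subspace_weight_space]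
  have zero_supported: "0 \<in> supported I" for I :: "(int \<times> nat) set"
    by (simp add: supported_def)
  have zero: "0 \<in> carrier ?D"
    unfolding carrier zero_prod_def
    using vs.subspace_0[OF subspace_weight_space] zero_supported by blast
  have add: "z + z' \<in> carrier ?D \<and> ?g (z + z') = ?g z + ?g z'"
    if "z \<in> carrier ?D" "z' \<in> carrier ?D" for z z'
    using that unfolding carrier by (auto simp: W0_add supported_add glue_add algebra_simps)
  have scale: "scl ?D c z \<in> carrier ?D \<and> ?g (scl ?D c z) = c \<cdot> ?g z" if "z \<in> carrier ?D" for c z
    using that glue_scale[OF gp] glue_scale[OF gq] unfolding carrier
    by (auto simp: direct_sum2_def weight_rep_def W0_scale supported_super_weight_sum
        vs.scale_right_distrib)
  have kernel: "z = 0" if "z \<in> carrier ?D" "?g z = 0" for z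
  proof -
    from that(1) obtain v x y where z: "z = (v, x, y)" and v: "v \<in> weight_space R 0"
      and x: "x \<in> supported ?I" and y: "y \<in> supported ?J"
      unfolding carrier by blast
    define M where "M = fst ` ({i. x i \<noteq> 0} \<union> {i. y i \<noteq> 0})"
    have fin: "finite M"
      using x y by (simp add: M_def supported_def)
    have M: "m \<noteq> 0" if "m \<in> M" for m
      using that x y by (auto simp: M_def supported_def multiplicity_index_def)
    have xM: "m \<in> M" if "x (m, j) \<noteq> 0" for m j
      unfolding M_def using that by (intro image_eqI[of _ _ "(m, j)"]) auto
    have yM: "m \<in> M" if "y (m, j) \<noteq> 0" for m j
      unfolding M_def using that by (intro image_eqI[of _ _ "(m, j)"]) auto
    \<comment> \<open>The component of \<open>?g z\<close> of weight \<open>m\<close>. The index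
      sets contain no pair of weight 0, so \<open>v\<close> alone accounts for that
      component.\<close>
    define w where "w m = (if m = 0 then v else
      (\<Sum>j<p m. block (r m) (e (m, j)) (x (m, j))) + (\<Sum>j<q m. block (r m) (f (m, j)) (y (m, j))))"
      for m
    have wt: "w m \<in> weight_space R m" for m
      using v fe[of m] ff[of m] US_eigenspaceD(2) unfolding w_def frame_def
      by (auto intro!: W0_add vs.subspace_sum[OF subspace_weight_space] block_weight)
    have "(\<Sum>m\<in>insert 0 M. w m) = v + (\<Sum>m\<in>M. w m)"
      using fin M by (subst sum.insert) (auto simp: w_def)
    also have "(\<Sum>m\<in>M. w m) = glue r e x + glue r f y"
      using M glue_by_weight[OF x fin xM, where r = r and e = e] glue_by_weight[OF y fin yM, where r = r and e = f]
      by (auto simp: w_def sum.distrib[symmetric] intro!: sum.cong)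
    also have "v + \<dots> = 0" using that(2) z by simp
    finally have w0: "w m = 0" if "m \<in> insert 0 M" for m
      using weights_independent[of "insert 0 M" w m] fin wt that by blast
    have "v = 0" using w0[of 0] by (simp add: w_def)
    moreover have local: "(\<forall>j<p m. x (m, j) = 0) \<and> (\<forall>j<q m. y (m, j) = 0)" if "m \<in> M" for m
    proof -
      have "(\<Sum>j<p m. block (r m) (e (m, j)) (x (m, j))) +
          (\<Sum>j<q m. block (r m) (f (m, j)) (y (m, j))) = 0"
        using w0[of m] that M[OF that] by (simp add: w_def)
      from blocks_independent[OF M[OF that] r0[OF M[OF that]] fe ff this] show ?thesis by blast
    qed
    have "x i = 0" for i
    proof (rule ccontr)
      assume i: "x i \<noteq> 0"
      then have "snd i < p (fst i)" "fst i \<in> M"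
        using x xM[of "fst i" "snd i"] by (auto simp: supported_def multiplicity_index_def)
      with local[of "fst i"] i show False by (metis prod.collapse)
    qed
    moreover have "y i = 0" for i
    proof (rule ccontr)
      assume i: "y i \<noteq> 0"
      then have "snd i < q (fst i)" "fst i \<in> M"
        using y yM[of "fst i" "snd i"] by (auto simp: supported_def multiplicity_index_def)
      with local[of "fst i"] i show False by (metis prod.collapse)
    qed
    ultimately show ?thesis
      by (simp add: z zero_prod_def fun_eq_iff)
  qed
  have inj: "inj_on ?g (carrier ?D)"
  proof (rule inj_onI)
    fix z z' assume z: "z \<in> carrier ?D" "z' \<in> carrier ?D" "?g z = ?g z'"
    let ?n = "scl ?D (- 1) z'"
    have neg: "?n = - z'"
      by (auto simp: direct_sum2_def weight_rep_def fun_eq_iff super_weight_sum_simps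
          vec_eq_iff split: prod.split)
    have "z + ?n = 0"
    proof (rule kernel)
      show "z + ?n \<in> carrier ?D"
        using add scale z by blast
      have "?g (z + ?n) = ?g z + (- 1) \<cdot> ?g z'"
        using add[OF z(1)] scale[OF z(2), of "- 1"] by metis
      then show "?g (z + ?n) = 0" using z(3) by simp
    qed
    then show "z = z'" unfolding neg by simp
  qed
  have weight_image: "weight_space R m \<subseteq> ?g ` carrier ?D" for m
  proof
    fix v assume v: "v \<in> weight_space R m"
    show "v \<in> ?g ` carrier ?D"
    proof (cases "m = 0")
      case True
      have "?g (v, 0, 0) = v" by (simp add: glue_def)
      moreover have "(v, 0, 0) \<in> carrier ?D"
        unfolding carrier using v True zero_supported by blast
      ultimately show ?thesis by (rule image_eqI[OF sym])
    next
      case False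
      obtain x y where xy: "v = (\<Sum>j<p m. block (r m) (e (m, j)) (x j)) +
          (\<Sum>j<q m. block (r m) (f (m, j)) (y j))"
        using blocks_span[OF False r0[OF False] fe ff v] .
      \<comment> \<open>Places the coefficients of one decomposition into blocks at weight
        \<open>m\<close> and zero elsewhere, giving a family of finite support.\<close>
      define single where "single n h = (\<lambda>i::int \<times> nat. if fst i = m \<and> snd i < n then h (snd i) else 0)"
        for n and h :: "nat \<Rightarrow> complex^2"
      have single: "single (n m) h \<in> supported (multiplicity_index n)" for n h
      proof -
        have sub: "{i. single (n m) h i \<noteq> 0} \<subseteq> {m} \<times> {..<n m}"
          by (auto simp: single_def split: if_splits)
        moreover have "{m} \<times> {..<n m} \<subseteq> multiplicity_index n"
          using False by (auto simp: multiplicity_index_def)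
        ultimately show ?thesis
          unfolding supported_def using finite_subset[OF sub] by auto
      qed
      have glue_single: "glue r b (single (n m) h) = (\<Sum>j<n m. block (r m) (b (m, j)) (h j))" for n h b
      proof -
        have "glue r b (single (n m) h) =
            (\<Sum>k\<in>{m}. \<Sum>j<n k. block (r k) (b (k, j)) (single (n m) h (k, j)))"
          by (rule glue_by_weight[OF single]) (auto simp: single_def split: if_splits)
        then show ?thesis by (simp add: single_def)
      qed
      have "?g (0, single (p m) x, single (q m) y) = v"
        by (simp add: glue_single xy)
      moreover have "(0, single (p m) x, single (q m) y) \<in> carrier ?D"
        unfolding carrier using single vs.subspace_0[OF subspace_weight_space] by blast
      ultimately show ?thesis by (rule image_eqI[OF sym])
    qed
  qed
  have image: "?g ` carrier ?D = V"
  proof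
    show "?g ` carrier ?D \<subseteq> V"
      unfolding carrier using glue_V[OF gp] glue_V[OF gq] weight_V by (auto intro!: V_add)
    have "vs.subspace (?g ` carrier ?D)"
    proof (rule vs.subspaceI)
      have "?g 0 = 0" by (simp add: zero_prod_def glue_def)
      from image_eqI[where f = ?g, OF sym[OF this] zero] show "0 \<in> ?g ` carrier ?D" .
      show "a + b \<in> ?g ` carrier ?D" if "a \<in> ?g ` carrier ?D" "b \<in> ?g ` carrier ?D" for a b
      proof -
        from that obtain z z' where z: "z \<in> carrier ?D" "z' \<in> carrier ?D"
          and ab: "a = ?g z" "b = ?g z'" by blast
        note sum = add[OF z]
        show ?thesis
          unfolding ab by (rule image_eqI[where f = ?g, OF sym[OF conjunct2[OF sum]] conjunct1[OF sum]])
      qed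
      show "c \<cdot> a \<in> ?g ` carrier ?D" if "a \<in> ?g ` carrier ?D" for c a
      proof -
        from that obtain z where z: "z \<in> carrier ?D" and a: "a = ?g z" by blast
        note scaled = scale[OF z, of c]
        show ?thesis
          unfolding a by (rule image_eqI[where f = ?g, OF sym[OF conjunct2[OF scaled]] conjunct1[OF scaled]])
      qed
    qed
    \<comment> \<open>As \<open>V\<close> is the span of its weight spaces, only vectors of a single
      weight have to be reached.\<close>
    then show "V \<subseteq> ?g ` carrier ?D"
      unfolding carrier_eq_weight_sum weight_sum_def
      by (intro vs.span_minimal) (use weight_image in blast)+
  qed
  show ?thesis
  proof (rule inverse_isomorphism[of ?g])
    show "bij_betw ?g (carrier ?D) V"
      using inj image by (simp add: bij_betw_def)
    show "z \<in> carrier ?D \<and> ?g z \<in> ev R" if "z \<in> ev ?D" for z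
      using that glue_even[OF gp] glue_even[OF gq] unfolding carrier
      by (auto simp: direct_sum2_def weight_rep_def super_weight_sum_simps
          intro!: vs.subspace_add[OF subspace_even])
    show "z \<in> carrier ?D \<and> ?g z \<in> od R" if "z \<in> od ?D" for z
      using that glue_odd[OF gp] glue_odd[OF gq] unfolding carrier
      by (auto simp: direct_sum2_def weight_rep_def super_weight_sum_simps
          intro!: vs.subspace_add[OF subspace_odd])
    show "act ?D t z \<in> carrier ?D \<and> ?g (act ?D t z) = act R t (?g z)"
      if t: "t \<in> S1" and z: "z \<in> carrier ?D" for t z
    proof -
      from z obtain v x y where z: "z = (v, x, y)" and v: "v \<in> weight_space R 0"
        and x: "x \<in> supported ?I" and y: "y \<in> supported ?J"
        unfolding carrier by blast
      have "act ?D t z = (act R t v, act ?P t x, act ?Q t y)"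
        by (simp add: z direct_sum2_def weight_rep_def)
      moreover have "act R t v \<in> weight_space R 0"
        using v t by (simp add: weight_space_def)
      moreover have "act R t (?g z) = act R t v + (act R t (glue r e x) + act R t (glue r f y))"
        using glue_V[OF gp x] glue_V[OF gq y] weight_V[OF v] by (simp add: z act_add[OF t] V_add)
      ultimately show ?thesis
        unfolding carrier using x y
        by (simp add: supported_super_weight_sum glue_act[OF gp x t] glue_act[OF gq y t])
    qed
    show "rho ?D X z \<in> carrier ?D \<and> ?g (rho ?D X z) = rho R X (?g z)"
      if X: "X \<in> su11" and z: "z \<in> carrier ?D" for X z
    proof -
      from z obtain v x y where z: "z = (v, x, y)" and v: "v \<in> weight_space R 0"
        and x: "x \<in> supported ?I" and y: "y \<in> supported ?J"
        unfolding carrier by blast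
      have "rho ?D X z = (rho R X v, rho ?P X x, rho ?Q X y)"
        by (simp add: z direct_sum2_def weight_rep_def)
      moreover have "rho R X (?g z) = rho R X v + (rho R X (glue r e x) + rho R X (glue r f y))"
        using glue_V[OF gp x] glue_V[OF gq y] weight_V[OF v] by (simp add: z rho_add[OF X] V_add)
      ultimately show ?thesis
        unfolding carrier using x y weight_rho[OF X v]
        by (simp add: supported_super_weight_sum glue_rho[OF gp x X] glue_rho[OF gq y X])
    qed
  qed (use add scale zero in blast)+
qed

end

theorem theorem4p2:
  fixes R :: "('v::ab_group_add) su11_data"
    and r :: "int \<Rightarrow> complex"
  assumes "su11_representation R"
    and "\<And>m. finite_dimensional R (weight_space R m)"
    and "\<And>m. m \<noteq> 0 \<Longrightarrow> (r m)\<^sup>2 = - \<i> * of_int m"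
  shows "\<exists>p q :: int \<Rightarrow> nat.
    isomorphic R
      (direct_sum2 (weight_rep R 0)
        (direct_sum2
          (direct_sum (multiplicity_index p) (\<lambda>(m, j). W_plus (r m) m))
          (direct_sum (multiplicity_index q) (\<lambda>(k, j). W_minus (r k) k))))"
proof -
  interpret su11_representation R by fact
  \<comment> \<open>Frames are chosen for all weights at once, 0 included;
    \<open>multiplicity_index\<close> discards the entries at 0, whose place is taken by
    \<open>weight_rep R 0\<close>.\<close>
  obtain p e where e: "\<And>m. frame 1 m (p m) (e m)"
    using frame_exists[OF assms(2)] by metis
  obtain q f where f: "\<And>m. frame (- 1) m (q m) (f m)"
    using frame_exists[OF assms(2)] by metis
  show ?thesis
    using isomorphic_decomposition[of r p "\<lambda>(m, j). e m j" q "\<lambda>(m, j). f m j"] assms(3) e f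
    unfolding super_weight_sum_def by auto
qed

end
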